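(* Let $f^i:M^i\to\mathbb{R}^n$ $(i\in\mathbb{N})$ be smooth proper immersions of $m$-manifolds without boundary with $0\in f^i(M^i)$, such that, with $\mu^i=f^i(\mu_{g^i})$ and constants independent of $i$, $\mu^i(B_R)\le C(R)$ and $\|\nabla^kA^i\|_{L^\infty(B_R)}\le C_k(R)$ for any $R>0$ and $k\in\mathbb{N}_0$. Let $f:M\to\mathbb{R}^n$ be a proper immersion of an $m$-manifold $M$ without boundary, and suppose (as is the case after passing to a subsequence, for a suitable limit $f$) that there are open sets $U^i\subset M$ with $U^i\subset\subset U^{i+1}$, $M=\bigcup_{i=1}^\infty U^i$, and diffeomorphisms $\phi^i:U^i\to(f^i)^{-1}(B_i)\subset M^i$ such that $\|f^i\circ\phi^i-f\|_{C^0(U^i)}\to0$ and $f^i\circ\phi^i\to f$ locally smoothly on $M$. Let $\mu=f(\mu_g)$. Then $\mu^i\to\mu$ in $C_c^0(\mathbb{R}^n)'$ as $i\to\infty$, that is, $$\lim_{i\to\infty}\int_{\mathbb{R}^n}\varphi\,d\mu^i=\int_{\mathbb{R}^n}\varphi\,d\mu\qquad\text{for all }\varphi\in C_c^0(\mathbb{R}^n).$$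
   Context: For a proper immersion $f:M\to\mathbb{R}^n$, $g$ denotes the induced metric on $M$ and $\mu_g$ its volume measure; $\mu=f(\mu_g)$ is the Radon measure on $\mathbb{R}^n$ with $\mu(E)=\mu_g(f^{-1}(E))$. $B_R\subset\mathbb{R}^n$ is the open ball of radius $R$ centered at the origin, and $\|\cdot\|_{L^\infty(B_R)}$ abbreviates the $L^\infty$-norm on $(f^i)^{-1}(B_R)$. $A^i$ is the second fundamental form of $f^i$ and $\nabla^kA^i$ its $k$-th covariant derivative. $U\subset\subset V$ means that $\overline U$ is a compact subset of $V$. "Locally smoothly" means convergence in the weak $C^\infty$-topology on $M$, i.e. uniform convergence on compact subsets of charts of derivatives of all orders. *)

theory Defs
  imports "HOL-Analysis.Analysis" "HOL-Probability.Essential_Supremum"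
begin

section \<open>Smooth functions on open subsets of Euclidean space\<close>

definition partial :: "'m::finite \<Rightarrow> (real^'m \<Rightarrow> 'b::real_normed_vector) \<Rightarrow> real^'m \<Rightarrow> 'b"
  where "partial a F x = frechet_derivative F (at x) (axis a 1)"

definition partials :: "'m::finite list \<Rightarrow> (real^'m \<Rightarrow> 'b::real_normed_vector) \<Rightarrow> real^'m \<Rightarrow> 'b"
  where "partials as F = foldr partial as F"

text \<open>Only used for open \<open>S\<close>.\<close>

definition smooth_on :: "(real^'m::finite) set \<Rightarrow> (real^'m \<Rightarrow> 'b::real_normed_vector) \<Rightarrow> bool"
  where "smooth_on S F \<longleftrightarrow> (\<forall>as. \<forall>x\<in>S. partials as F differentiable (at x))"


section \<open>Smooth manifolds without boundary\<close>

text \<open>A chart \<open>(U, \<xi>)\<close> is only meaningful on its domain \<open>U\<close>. The atlas need not be maximal; none of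
  the notions below depends on the choice of an atlas within its equivalence class.\<close>

type_synonym ('a, 'm) chart = "'a set \<times> ('a \<Rightarrow> real^'m)"

record ('a, 'm) manifold =
  mtop :: "'a topology"
  atlas :: "('a, 'm) chart set"

abbreviation carrier :: "('a, 'm::finite) manifold \<Rightarrow> 'a set"
  where "carrier M \<equiv> topspace (mtop M)"

definition in_chart :: "('a \<Rightarrow> 'b) \<Rightarrow> ('a, 'm::finite) chart \<Rightarrow> real^'m \<Rightarrow> 'b"
  where "in_chart h c = h \<circ> inv_into (fst c) (snd c)"

definition smooth_manifold :: "('a, 'm::finite) manifold \<Rightarrow> bool"
  where "smooth_manifold M \<longleftrightarrow>
    Hausdorff_space (mtop M) \<and> second_countable (mtop M) \<and>
    (\<Union>c\<in>atlas M. fst c) = carrier M \<and>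
    (\<forall>(U, \<xi>)\<in>atlas M. openin (mtop M) U \<and> open (\<xi> ` U) \<and>
      homeomorphic_map (subtopology (mtop M) U) (top_of_set (\<xi> ` U)) \<xi>) \<and>
    (\<forall>(U, \<xi>)\<in>atlas M. \<forall>(V, \<eta>)\<in>atlas M. smooth_on (\<xi> ` (U \<inter> V)) (in_chart \<eta> (U, \<xi>)))"

definition smooth_between ::
    "('a, 'm::finite) manifold \<Rightarrow> 'a set \<Rightarrow> ('b, 'm) manifold \<Rightarrow> 'b set \<Rightarrow> ('a \<Rightarrow> 'b) \<Rightarrow> bool"
  where "smooth_between M S N T h \<longleftrightarrow>
    continuous_map (subtopology (mtop M) S) (subtopology (mtop N) T) h \<and>
    (\<forall>(U, \<xi>)\<in>atlas M. \<forall>(V, \<eta>)\<in>atlas N.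
      smooth_on (\<xi> ` {p \<in> U \<inter> S. h p \<in> V}) (in_chart (\<eta> \<circ> h) (U, \<xi>)))"

definition diffeomorphism ::
    "('a, 'm::finite) manifold \<Rightarrow> 'a set \<Rightarrow> ('b, 'm) manifold \<Rightarrow> 'b set \<Rightarrow> ('a \<Rightarrow> 'b) \<Rightarrow> bool"
  where "diffeomorphism M S N T h \<longleftrightarrow>
    bij_betw h S T \<and> smooth_between M S N T h \<and> smooth_between N T M S (inv_into S h)"

definition smooth_immersion :: "('a, 'm::finite) manifold \<Rightarrow> ('a \<Rightarrow> real^'n::finite) \<Rightarrow> bool"
  where "smooth_immersion M f \<longleftrightarrow>
    (\<forall>c\<in>atlas M. smooth_on (snd c ` fst c) (in_chart f c) \<and>
      (\<forall>x\<in>snd c ` fst c. inj (frechet_derivative (in_chart f c) (at x))))"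

definition proper_immersion :: "('a, 'm::finite) manifold \<Rightarrow> ('a \<Rightarrow> real^'n::finite) \<Rightarrow> bool"
  where "proper_immersion M f \<longleftrightarrow> smooth_immersion M f \<and> proper_map (mtop M) euclidean f"


section \<open>Geometry of a parametrised immersion \<open>F\<close>\<close>

definition metric :: "(real^'m::finite \<Rightarrow> real^'n::finite) \<Rightarrow> real^'m \<Rightarrow> real^'m^'m"
  where "metric F x = (\<chi> a b. partial a F x \<bullet> partial b F x)"

definition metric_inv :: "(real^'m::finite \<Rightarrow> real^'n::finite) \<Rightarrow> real^'m \<Rightarrow> real^'m^'m"
  where "metric_inv F x = matrix_inv (metric F x)"

text \<open>\<open>christoffel F d a b\<close> is \<open>\<Gamma>\<^sup>d\<^sub>a\<^sub>b\<close>.\<close>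

definition christoffel ::
    "(real^'m::finite \<Rightarrow> real^'n::finite) \<Rightarrow> 'm \<Rightarrow> 'm \<Rightarrow> 'm \<Rightarrow> real^'m \<Rightarrow> real"
  where "christoffel F d a b x =
    (\<Sum>e\<in>UNIV. metric_inv F x $ d $ e *
      (partial a (\<lambda>y. metric F y $ b $ e) x + partial b (\<lambda>y. metric F y $ a $ e) x
        - partial e (\<lambda>y. metric F y $ a $ b) x)) / 2"

text \<open>Orthogonal projection onto the normal space of \<open>F\<close> at \<open>x\<close>.\<close>

definition normal_proj ::
    "(real^'m::finite \<Rightarrow> real^'n::finite) \<Rightarrow> real^'m \<Rightarrow> real^'n \<Rightarrow> real^'n"
  where "normal_proj F x v =
    v - (\<Sum>a\<in>UNIV. \<Sum>b\<in>UNIV. (metric_inv F x $ a $ b * (v \<bullet> partial a F x)) *\<^sub>R partial b F x)"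

text \<open>A normal-valued covariant tensor of rank \<open>r\<close> is given by its components, indexed by lists of
  length \<open>r\<close>; in particular \<open>second_fund\<close> is meant for lists of length \<open>2\<close>.\<close>

definition second_fund ::
    "(real^'m::finite \<Rightarrow> real^'n::finite) \<Rightarrow> 'm list \<Rightarrow> real^'m \<Rightarrow> real^'n"
  where "second_fund F as x = normal_proj F x (partials as F x)"

text \<open>Covariant differentiation by the normal connection on values and the Levi-Civita connection on
  arguments; the new argument comes first.\<close>

definition cov_deriv ::
    "(real^'m::finite \<Rightarrow> real^'n::finite) \<Rightarrow> ('m list \<Rightarrow> real^'m \<Rightarrow> real^'n) \<Rightarrow>
      'm list \<Rightarrow> real^'m \<Rightarrow> real^'n"
  where "cov_deriv F T cas x =
    (let c = hd cas; as = tl cas in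
      normal_proj F x (partial c (T as) x)
      - (\<Sum>j<length as. \<Sum>d\<in>UNIV. christoffel F d c (as ! j) x *\<^sub>R T (as[j := d]) x))"

definition nabla_A ::
    "nat \<Rightarrow> (real^'m::finite \<Rightarrow> real^'n::finite) \<Rightarrow> 'm list \<Rightarrow> real^'m \<Rightarrow> real^'n"
  where "nabla_A k F = (cov_deriv F ^^ k) (second_fund F)"

definition tensor_norm ::
    "nat \<Rightarrow> (real^'m::finite \<Rightarrow> real^'n::finite) \<Rightarrow> ('m list \<Rightarrow> real^'m \<Rightarrow> real^'n) \<Rightarrow> real^'m \<Rightarrow> real"
  where "tensor_norm r F T x =
    sqrt (\<Sum>as | length as = r. \<Sum>bs | length bs = r.
      (\<Prod>j<r. metric_inv F x $ (as ! j) $ (bs ! j)) * (T as x \<bullet> T bs x))"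


section \<open>Geometry of an immersed manifold\<close>

text \<open>The pointwise norm of the \<open>k\<close>-th covariant derivative of the second fundamental form. It is
  computed in some chart around \<open>p\<close>; being the norm of a tensor, it does not depend on the chart.\<close>

definition norm_nabla_A ::
    "nat \<Rightarrow> ('a, 'm::finite) manifold \<Rightarrow> ('a \<Rightarrow> real^'n::finite) \<Rightarrow> 'a \<Rightarrow> real"
  where "norm_nabla_A k M f p =
    (let c = (SOME c. c \<in> atlas M \<and> p \<in> fst c); F = in_chart f c
     in tensor_norm (k + 2) F (nabla_A k F) (snd c p))"

text \<open>The unique Borel measure that has density \<open>\<surd>(det g)\<close> with respect to Lebesgue measure in every
  chart.\<close>

definition volume_measure ::
    "('a, 'm::finite) manifold \<Rightarrow> ('a \<Rightarrow> real^'n::finite) \<Rightarrow> 'a measure"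
  where "volume_measure M f = (THE \<nu>.
    sets \<nu> = sigma_sets (carrier M) {W. openin (mtop M) W} \<and>
    (\<forall>(U, \<xi>)\<in>atlas M. \<forall>E\<in>sets \<nu>. E \<subseteq> U \<longrightarrow>
      emeasure \<nu> E =
        (\<integral>\<^sup>+x\<in>\<xi> ` E. ennreal (sqrt (det (metric (in_chart f (U, \<xi>)) x))) \<partial>lborel)))"

definition image_measure ::
    "('a, 'm::finite) manifold \<Rightarrow> ('a \<Rightarrow> real^'n::finite) \<Rightarrow> (real^'n) measure"
  where "image_measure M f = distr (volume_measure M f) borel f"

definition Linf_norm :: "'a measure \<Rightarrow> 'a set \<Rightarrow> ('a \<Rightarrow> real) \<Rightarrow> ereal"
  where "Linf_norm \<nu> S h = esssup (restrict_space \<nu> S) (\<lambda>p. ereal \<bar>h p\<bar>)"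

definition preimage :: "('a, 'm::finite) manifold \<Rightarrow> ('a \<Rightarrow> 'b) \<Rightarrow> 'b set \<Rightarrow> 'a set"
  where "preimage M f S = {p \<in> carrier M. f p \<in> S}"


section \<open>Modes of convergence\<close>

definition compactly_inside :: "('a, 'm::finite) manifold \<Rightarrow> 'a set \<Rightarrow> 'a set \<Rightarrow> bool"
  where "compactly_inside M S T \<longleftrightarrow>
    compactin (mtop M) (mtop M closure_of S) \<and> mtop M closure_of S \<subseteq> T"

definition C0_norm :: "'a set \<Rightarrow> ('a \<Rightarrow> 'b::real_normed_vector) \<Rightarrow> ennreal"
  where "C0_norm S h = (SUP p\<in>S. ennreal (norm (h p)))"

text \<open>The maps \<open>h i\<close> may be defined only on open sets exhausting the manifold: every compact set
  lies in all but finitely many of them.\<close>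

definition locally_smooth_limit ::
    "('a, 'm::finite) manifold \<Rightarrow> (nat \<Rightarrow> 'a \<Rightarrow> real^'n::finite) \<Rightarrow> ('a \<Rightarrow> real^'n) \<Rightarrow> bool"
  where "locally_smooth_limit M h f \<longleftrightarrow>
    (\<forall>c\<in>atlas M. \<forall>K. compact K \<and> K \<subseteq> snd c ` fst c \<longrightarrow>
      (\<forall>as. uniform_limit K (\<lambda>i. partials as (in_chart (h i) c)) (partials as (in_chart f c))
        sequentially))"

end

theory Submission
  imports Defs
begin

text \<open>In a chart the volume measure of an immersion has the density \<open>\<surd>(det g)\<close>, and by the change of
  variables formula this density transforms consistently, so the volume measure exists, is unique, and
  is computed by the same formula in every compatible chart. In particular, pushing a chart of \<open>M\<close>
  forward by \<open>\<phi> i\<close> gives a chart of \<open>Ms i\<close> in which the volume of \<open>fs i\<close> has the density of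
  \<open>fs i \<circ> \<phi> i\<close>.

  Let the support of \<open>\<psi>\<close> lie in the ball of radius \<open>R\<close>. By uniform closeness of \<open>fs i \<circ> \<phi> i\<close> to \<open>f\<close>, for
  large \<open>i\<close> the integrand \<open>\<psi> \<circ> fs i\<close> lives on the image under \<open>\<phi> i\<close> of the set of points that \<open>f\<close> maps
  into the closed ball of radius \<open>R + 1\<close>, which is compact as \<open>f\<close> is proper. Cutting this set into
  finitely many Borel pieces inside chart balls, each piece contributes an integral over a fixed bounded
  set whose integrand depends continuously on the 1-jet of \<open>fs i \<circ> \<phi> i\<close>, and dominated convergence
  applies.\<close>

section \<open>Change of variables for nonnegative functions\<close>

text \<open>The library's change of variables formula is restricted to index types of class \<open>wellorder\<close>. It is
  transferred to an arbitrary finite index type along a copy of that type with an arbitrary well-order.\<close>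

datatype 'a wo = Wo (un_wo: 'a)

instance wo :: (finite) finite
proof
  have "(UNIV :: 'a::finite wo set) = range Wo" by (metis surjI wo.collapse)
  then show "finite (UNIV :: 'a wo set)" by (metis finite finite_imageI)
qed

instantiation wo :: (finite) wellorder
begin

text \<open>The order is pulled back from the naturals along the injection \<open>to_nat\<close>, so
  it is linear and inherits well-foundedness.\<close>

definition "x \<le> y \<longleftrightarrow> to_nat (un_wo x) \<le> to_nat (un_wo y)"
definition "x < y \<longleftrightarrow> to_nat (un_wo x) < to_nat (un_wo y)"

instance
proof
  fix P :: "'a wo \<Rightarrow> bool" and a
  assume step: "\<And>x. (\<And>y. y < x \<Longrightarrow> P y) \<Longrightarrow> P x"
  show "P a"
    by (induction "to_nat (un_wo a)" arbitrary: a rule: less_induct)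
       (use step less_wo_def in blast)
qed (auto simp: less_eq_wo_def less_wo_def wo.expand)

end

section \<open>Reindexing coordinates along a bijection of index types\<close>

lemma bij_Wo: "bij Wo"
  by (metis bijI' wo.collapse wo.inject)

lemma bij_un_wo: "bij un_wo"
  by (metis bijI' wo.collapse wo.sel)

text \<open>Conjugation with \<open>p\<close> matches the permutations of the two index types and
  preserves signs, so the Leibniz expansions agree term by term.\<close>

lemma det_reindex:
  fixes A :: "'c::comm_ring_1^'m::finite^'m"
  assumes p: "bij (p :: 'k::finite \<Rightarrow> 'm)"
  shows "det (\<chi> i j. A $ p i $ p j) = det A"
proof -
  have p': "bij_betw p UNIV UNIV" "inj p" using p by (auto simp: bij_is_inj)
  have "det A = (\<Sum>\<tau> | \<tau> permutes (UNIV::'m set). of_int (sign \<tau>) * (\<Prod>i\<in>UNIV. A $ i $ \<tau> i))"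
    by (simp add: det_def)
  also have "\<dots> = (\<Sum>\<sigma> | \<sigma> permutes (UNIV::'k set).
      of_int (sign (map_permutation UNIV p \<sigma>)) *
      (\<Prod>i\<in>UNIV. A $ i $ map_permutation UNIV p \<sigma> i))"
    apply (rule sum.reindex_bij_betw[symmetric])
    \<comment> \<open>The inverse of conjugation with \<open>p\<close> is conjugation with
      \<open>inv p\<close>.\<close>
    apply (rule bij_betw_byWitness[where f' = "map_permutation UNIV (inv p)"])
    using p by (auto simp: map_permutation_compose_inv bij_is_inj bij_is_surj surj_f_inv_f bij_imp_bij_inv
      intro!: map_permutation_compose_inv[where B = UNIV] map_permutation_permutes)
  also have "\<dots> = (\<Sum>\<sigma> | \<sigma> permutes (UNIV::'k set). of_int (sign \<sigma>) * (\<Prod>i\<in>UNIV. A $ p i $ p (\<sigma> i)))"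
  proof (intro sum.cong refl arg_cong2[where f = "(*)"])
    fix \<sigma> :: "'k \<Rightarrow> 'k" assume s: "\<sigma> \<in> {\<sigma>. \<sigma> permutes UNIV}"
    show "(of_int (sign (map_permutation UNIV p \<sigma>)) :: 'c) = of_int (sign \<sigma>)"
      using s p' by (simp add: sign_map_permutation)
    show "(\<Prod>i\<in>UNIV. A $ i $ map_permutation UNIV p \<sigma> i) = (\<Prod>i\<in>UNIV. A $ p i $ p (\<sigma> i))"
      by (subst prod.reindex_bij_betw[OF p'(1), symmetric])
         (simp add: map_permutation_apply[OF p'(2)])
  qed
  also have "\<dots> = det (\<chi> i j. A $ p i $ p j)" by (simp add: det_def)
  finally show ?thesis ..
qed

text \<open>Lebesgue measure is determined by its values on boxes, and permuting coordinates only
  permutes the side lengths in the product that gives the volume of a box.\<close>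

lemma nn_integral_lborel_reindex:
  fixes p :: "'k::finite \<Rightarrow> 'm::finite" and h :: "real^'k \<Rightarrow> ennreal"
  assumes p: "bij p" and [measurable]: "h \<in> borel_measurable borel"
  shows "(\<integral>\<^sup>+x. h (\<chi> i. x $ p i) \<partial>lborel) = (\<integral>\<^sup>+y. h y \<partial>lborel)"
proof -
  define r :: "real^'m \<Rightarrow> real^'k" where "r x = (\<chi> i. x $ p i)" for x
  have r[measurable]: "r \<in> borel_measurable borel"
    unfolding r_def by (intro borel_measurable_continuous_onI continuous_intros)
  have "lborel = distr lborel borel r"
  proof (rule lborel_eqI)
    fix l u :: "real^'k" assume le: "\<And>b. b \<in> Basis \<Longrightarrow> l \<bullet> b \<le> u \<bullet> b"
    let ?l = "(\<chi> j. l $ inv p j) :: real^'m" and ?u = "(\<chi> j. u $ inv p j) :: real^'m"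
    have le': "l $ i \<le> u $ i" for i
      using le[of "axis i 1"] by (simp add: inner_axis)
    have "r -` box l u = box ?l ?u"
      using p by (auto simp: r_def mem_box Basis_vec_def inner_axis) (metis bij_inv_eq_iff)+
    then have "emeasure (distr lborel borel r) (box l u) = emeasure lborel (box ?l ?u)"
      by (simp add: emeasure_distr)
    also have "\<dots> = ennreal (\<Prod>b\<in>Basis. (?u - ?l) \<bullet> b)"
      by (subst emeasure_lborel_box) (auto simp: Basis_vec_def inner_axis le')
    also have "(\<Prod>b\<in>Basis. (?u - ?l) \<bullet> b) = (\<Prod>j\<in>UNIV. u $ inv p j - l $ inv p j)"
      by (simp add: Basis_vec_def UNION_singleton_eq_range prod.reindex inj_on_def axis_eq_axis inner_axis
        o_def)
    also have "\<dots> = (\<Prod>i\<in>UNIV. u $ i - l $ i)"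
      using prod.reindex_bij_betw[OF bij_imp_bij_inv[OF p], of "\<lambda>i. u $ i - l $ i"] by simp
    also have "\<dots> = (\<Prod>b\<in>Basis. (u - l) \<bullet> b)"
      by (simp add: Basis_vec_def UNION_singleton_eq_range prod.reindex inj_on_def axis_eq_axis inner_axis
        o_def)
    finally show "emeasure (distr lborel borel r) (box l u) = ennreal (\<Prod>b\<in>Basis. (u - l) \<bullet> b)" .
  qed simp
  then have "(\<integral>\<^sup>+y. h y \<partial>lborel) = (\<integral>\<^sup>+y. h y \<partial>distr lborel borel r)" by simp
  also have "\<dots> = (\<integral>\<^sup>+x. h (r x) \<partial>lborel)" by (simp add: nn_integral_distr)
  finally show ?thesis by (simp add: r_def)
qed

text \<open>The formula for absolutely integrable functions is converted: for nonnegative functions,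
  absolute integrability is finiteness of the nonnegative integral.\<close>

lemma nn_integral_change_of_variables_wellorder:
  fixes f :: "real^'m::{finite,wellorder} \<Rightarrow> real" and g :: "real^'m::_ \<Rightarrow> real^'m::_"
  assumes S: "S \<in> sets borel" "g ` S \<in> sets borel"
    and der: "\<And>x. x \<in> S \<Longrightarrow> (g has_derivative g' x) (at x within S)"
    and inj: "inj_on g S"
    and nonneg: "\<And>y. f y \<ge> 0"
    and meas: "(\<lambda>y. indicator (g ` S) y * f y) \<in> borel_measurable borel"
      "(\<lambda>x. indicator S x * (\<bar>det (matrix (g' x))\<bar> * f (g x))) \<in> borel_measurable borel"
  shows "(\<integral>\<^sup>+y\<in>g ` S. ennreal (f y) \<partial>lborel) =
    (\<integral>\<^sup>+x\<in>S. ennreal (\<bar>det (matrix (g' x))\<bar> * f (g x)) \<partial>lborel)"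
proof -
  \<comment> \<open>The known formula concerns vector-valued functions; a real function is fed into
    it as a map to \<open>real^1\<close>.\<close>
  have cov: "(\<lambda>x. \<bar>det (matrix (g' x))\<bar> * f (g x)) absolutely_integrable_on S \<and>
           integral S (\<lambda>x. \<bar>det (matrix (g' x))\<bar> * f (g x)) = b
     \<longleftrightarrow> f absolutely_integrable_on (g ` S) \<and> integral (g ` S) f = b" for b
  proof -
    have "(\<lambda>x. \<bar>det (matrix (g' x))\<bar> *\<^sub>R (vec (f (g x)) :: real^1)) absolutely_integrable_on S \<and>
           integral S (\<lambda>x. \<bar>det (matrix (g' x))\<bar> *\<^sub>R (vec (f (g x)) :: real^1)) = vec b
     \<longleftrightarrow> (\<lambda>y. vec (f y) :: real^1) absolutely_integrable_on (g ` S) \<and> integral (g ` S) (\<lambda>y. vec (f y) :: real^1) = vec b"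
      by (rule has_absolute_integral_change_of_variables[OF _ der inj]) (use S in auto)
    moreover have "\<bar>det (matrix (g' x))\<bar> *\<^sub>R (vec (f (g x)) :: real^1) = vec (\<bar>det (matrix (g' x))\<bar> * f (g x))" for x
      by (simp add: vec_eq_iff)
    moreover have "((\<lambda>y. vec (h y) :: real^1) absolutely_integrable_on T \<and> integral T (\<lambda>y. vec (h y) :: real^1) = vec b) \<longleftrightarrow>
      (h absolutely_integrable_on T \<and> integral T h = b)" for T and h :: "real^'m::_ \<Rightarrow> real"
    proof -
      have "(\<lambda>y. vec (h y) :: real^1) absolutely_integrable_on T \<longleftrightarrow> h absolutely_integrable_on T"
        by (subst absolutely_integrable_componentwise_iff) (simp add: Basis_vec_def inner_axis)
      moreover have "integral T (\<lambda>y. vec (h y) :: real^1) = vec (integral T h)" if "h absolutely_integrable_on T"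
      proof -
        have "h integrable_on T" using that by (simp add: absolutely_integrable_on_def)
        then have "((\<lambda>y. vec (h y) :: real^1) has_integral vec (integral T h)) T"
          by (subst has_integral_componentwise_iff) (auto simp: Basis_vec_def inner_axis)
        then show ?thesis by (rule integral_unique)
      qed
      ultimately show ?thesis by (auto simp: vec_eq_iff)
    qed
    ultimately show ?thesis by simp
  qed
  \<comment> \<open>This links gauge integrals, which see the Lebesgue completion, with nonnegative
    integrals over \<open>lborel\<close>; Borel measurability of the cut-off function lets the
    completion be dropped.\<close>
  have conv: "h absolutely_integrable_on T \<longleftrightarrow> (\<integral>\<^sup>+y\<in>T. ennreal (h y) \<partial>lborel) < \<infinity>"
    "h absolutely_integrable_on T \<Longrightarrow> (\<integral>\<^sup>+y\<in>T. ennreal (h y) \<partial>lborel) = ennreal (integral T h)"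
    if "T \<in> sets borel" and [measurable]: "(\<lambda>y. indicator T y * h y) \<in> borel_measurable borel"
      and nn: "\<And>y. h y \<ge> 0" for T and h :: "real^'m::_ \<Rightarrow> real"
  proof -
    have m2: "(\<lambda>y. indicator T y * h y) \<in> borel_measurable lborel" by simp
    have eq: "(\<integral>\<^sup>+y\<in>T. ennreal (h y) \<partial>lborel) = (\<integral>\<^sup>+y. ennreal (indicator T y * h y) \<partial>lborel)"
      by (intro nn_integral_cong) (simp add: indicator_def)
    have 1: "h absolutely_integrable_on T \<longleftrightarrow> integrable lborel (\<lambda>y. indicator T y * h y)"
      unfolding set_integrable_def using integrable_completion[OF m2] by simp
    show "h absolutely_integrable_on T \<longleftrightarrow> (\<integral>\<^sup>+y\<in>T. ennreal (h y) \<partial>lborel) < \<infinity>"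
      unfolding 1 eq integrable_iff_bounded using nn by (simp add: abs_mult)
    assume ai: "h absolutely_integrable_on T"
    have "(\<integral>\<^sup>+y. ennreal (indicator T y * h y) \<partial>lborel) = ennreal (\<integral>y. indicator T y * h y \<partial>lborel)"
      using ai nn by (intro nn_integral_eq_integral) (auto simp: 1)
    also have "(\<integral>y. indicator T y * h y \<partial>lborel) = (LINT y:T|lebesgue. h y)"
      unfolding set_lebesgue_integral_def using integral_completion[OF m2] by simp
    also have "\<dots> = integral T h" using ai by (rule set_lebesgue_integral_eq_integral)
    finally show "(\<integral>\<^sup>+y\<in>T. ennreal (h y) \<partial>lborel) = ennreal (integral T h)" by (simp add: eq)
  qed
  note c1 = conv[OF S(2) meas(1) nonneg]
  note c2 = conv[OF S(1) meas(2)]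
  show ?thesis
    \<comment> \<open>The two instances carry integrability in opposite directions: if one side is
      finite, so is the other and they agree; otherwise both are infinite.\<close>
    using cov[of "integral (g ` S) f"] cov[of "integral S (\<lambda>x. \<bar>det (matrix (g' x))\<bar> * f (g x))"] c1 c2 nonneg
    by (metis (no_types, lifting) abs_ge_zero mult_nonneg_nonneg infinity_ennreal_def not_less top.extremum_unique)
qed

lemma nn_integral_change_of_variables:
  fixes f :: "real^'m::finite \<Rightarrow> real" and g :: "real^'m \<Rightarrow> real^'m"
  assumes S: "S \<in> sets borel" "g ` S \<in> sets borel"
    and der: "\<And>x. x \<in> S \<Longrightarrow> (g has_derivative g' x) (at x within S)"
    and inj: "inj_on g S"
    and nonneg: "\<And>y. f y \<ge> 0"
    and meas: "(\<lambda>y. indicator (g ` S) y * f y) \<in> borel_measurable borel"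
      "(\<lambda>x. indicator S x * (\<bar>det (matrix (g' x))\<bar> * f (g x))) \<in> borel_measurable borel"
  shows "(\<integral>\<^sup>+y\<in>g ` S. ennreal (f y) \<partial>lborel) =
    (\<integral>\<^sup>+x\<in>S. ennreal (\<bar>det (matrix (g' x))\<bar> * f (g x)) \<partial>lborel)"
proof -
  define r :: "real^'m \<Rightarrow> real^'m wo" where "r x = (\<chi> i. x $ un_wo i)" for x
  define q :: "real^'m wo \<Rightarrow> real^'m" where "q y = (\<chi> j. y $ Wo j)" for y
  have rq[simp]: "r (q y) = y" "q (r x) = x" for x y
    by (simp_all add: r_def q_def vec_eq_iff)
  have cont: "continuous_on A r" "continuous_on B q" for A B
    unfolding r_def q_def by (intro continuous_intros)+
  have [measurable]: "r \<in> borel_measurable borel" "q \<in> borel_measurable borel"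
    using cont by (auto intro: borel_measurable_continuous_onI)
  have blr: "bounded_linear r"
    unfolding r_def by (intro linear_conv_bounded_linear[THEN iffD1] linearI) (simp_all add: vec_eq_iff)
  have blq: "bounded_linear q"
    unfolding q_def by (intro linear_conv_bounded_linear[THEN iffD1] linearI) (simp_all add: vec_eq_iff)
  have im: "r ` T = q -` T" for T by (auto simp: image_iff intro: exI[of _ "q _"]) (metis rq(1))
  have rb: "r ` T \<in> sets borel" if "T \<in> sets borel" for T
    using measurable_sets[of q borel borel T] that by (simp add: im)
  \<comment> \<open>The map is conjugated to the well-ordered copy of the coordinate space. The
    matrix of its derivative is merely reindexed, so \<open>det_reindex\<close> keeps the Jacobian
    factor.\<close>
  define g2 where "g2 = r \<circ> g \<circ> q"
  define g2' where "g2' y = r \<circ> g' (q y) \<circ> q" for y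
  have g2S: "g2 ` r ` S = r ` g ` S" by (auto simp: g2_def image_comp)
  have ind: "indicator (r ` T) y = (indicator T (q y) :: 'z::zero_neq_one)" for T y
    by (simp add: im indicator_def)
  have det: "det (matrix (g2' y)) = det (matrix (g' (q y)))" for y
  proof -
    have "q (axis j 1) = axis (un_wo j) 1" for j :: "'m wo"
      by (auto simp: q_def axis_def vec_eq_iff)
    then have "matrix (g2' y) = (\<chi> i j. matrix (g' (q y)) $ un_wo i $ un_wo j)"
      by (simp add: matrix_def g2'_def r_def)
    then show ?thesis by (simp add: det_reindex bij_un_wo)
  qed
  have ident: "(\<integral>\<^sup>+y. h (q y) \<partial>lborel) = (\<integral>\<^sup>+x. h x \<partial>lborel)"
    if "h \<in> borel_measurable borel" for h :: "real^'m \<Rightarrow> ennreal"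
    unfolding q_def using nn_integral_lborel_reindex[OF bij_Wo that] .
  have ind_mult: "ennreal (indicator T x * c) = ennreal c * indicator T x" for T c and x :: "real^'m"
    by (simp split: split_indicator)
  have meas': "(\<lambda>y. ennreal (f y) * indicator (g ` S) y) \<in> borel_measurable borel"
    "(\<lambda>x. ennreal (\<bar>det (matrix (g' x))\<bar> * f (g x)) * indicator S x) \<in> borel_measurable borel"
    using meas[THEN measurable_compose, OF measurable_ennreal] by (simp_all add: ind_mult)
  have "(\<integral>\<^sup>+y\<in>g ` S. ennreal (f y) \<partial>lborel) = (\<integral>\<^sup>+y\<in>g2 ` r ` S. ennreal (f (q y)) \<partial>lborel)"
    by (subst ident[OF meas'(1), symmetric]) (simp add: g2S ind)
  also have "\<dots> = (\<integral>\<^sup>+x\<in>r ` S. ennreal (\<bar>det (matrix (g2' x))\<bar> * f (q (g2 x))) \<partial>lborel)"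
  proof (rule nn_integral_change_of_variables_wellorder)
    show "r ` S \<in> sets borel" "g2 ` r ` S \<in> sets borel" using rb S by (auto simp: g2S)
    show "inj_on g2 (r ` S)" using inj unfolding g2_def inj_on_def by (metis comp_apply imageE rq(2))
    show "(\<lambda>y. indicator (g2 ` r ` S) y * f (q y)) \<in> borel_measurable borel"
      unfolding g2S ind by (rule measurable_compose[OF _ meas(1)]) simp
    show "(\<lambda>x. indicator (r ` S) x * (\<bar>det (matrix (g2' x))\<bar> * f (q (g2 x)))) \<in> borel_measurable borel"
      unfolding ind det g2_def o_def rq by (rule measurable_compose[OF _ meas(2)]) simp
    fix y assume "y \<in> r ` S"
    then have "(g has_derivative g' (q y)) (at (q y) within q ` r ` S)"
      using der by (auto simp: image_image)
    then have "(g \<circ> q has_derivative g' (q y) \<circ> q) (at y within r ` S)"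
      by (intro diff_chain_within bounded_linear_imp_has_derivative[OF blq])
    then show "(g2 has_derivative g2' y) (at y within r ` S)"
      unfolding g2_def g2'_def comp_assoc
      by (rule diff_chain_within[OF _ bounded_linear_imp_has_derivative[OF blr]])
  qed (rule nonneg)
  also have "\<dots> = (\<integral>\<^sup>+x\<in>S. ennreal (\<bar>det (matrix (g' x))\<bar> * f (g x)) \<partial>lborel)"
    by (subst ident[OF meas'(2), symmetric]) (simp add: det ind g2_def)
  finally show ?thesis .
qed

section \<open>The volume density of a parametrised map\<close>

text \<open>Volume densities and Jacobians involve first derivatives only, and this regularity
  passes to compositions by one use of the chain rule.\<close>

definition C1_on :: "(real^'m::finite) set \<Rightarrow> (real^'m \<Rightarrow> 'b::real_normed_vector) \<Rightarrow> bool"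
  where "C1_on S F \<longleftrightarrow>
    (\<forall>x\<in>S. F differentiable (at x)) \<and> (\<forall>a. continuous_on S (partial a F))"

lemma smooth_on_imp_C1_on: 
  assumes "smooth_on S F" shows "C1_on S F"
proof -
  have "partials [] F differentiable (at x)" "partials [a] F differentiable (at x)" if "x \<in> S" for a x
    using assms that unfolding smooth_on_def by blast+
  then show ?thesis
    unfolding C1_on_def partials_def
    by (auto intro!: continuous_at_imp_continuous_on differentiable_imp_continuous_within)
qed

section \<open>Locality and composition of C1 maps\<close>

lemma C1_on_subset: "C1_on S F \<Longrightarrow> T \<subseteq> S \<Longrightarrow> C1_on T F"
  unfolding C1_on_def by (blast intro: continuous_on_subset)

lemma C1_on_imp_continuous_on: "C1_on S F \<Longrightarrow> continuous_on S F"
  unfolding C1_on_def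
  by (auto intro!: continuous_at_imp_continuous_on differentiable_imp_continuous_within)

lemma partial_cong_open:
  assumes "open S" "x \<in> S" "F differentiable (at x)" "\<And>x. x \<in> S \<Longrightarrow> F x = G x"
  shows "partial a F x = partial a G x"
  unfolding partial_def
  using frechet_derivative_transform_within_open[OF assms(3,1,2,4)] by simp

text \<open>Coordinate representations of the same map are known to agree only on a chart image.
  Openness of that set makes their derivatives agree as well.\<close>

lemma C1_on_cong:
  assumes "open S" "C1_on S F" "\<And>x. x \<in> S \<Longrightarrow> F x = G x"
  shows "C1_on S G"
proof -
  have d: "F differentiable (at x)" if "x \<in> S" for x using assms that by (auto simp: C1_on_def)
  have "G differentiable (at x)" if "x \<in> S" for x
    using d[OF that] has_derivative_transform_within_open[of F _ x UNIV S G] assms(1,3) that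
    unfolding differentiable_def by blast
  moreover have "continuous_on S (partial a G)" for a
    using assms(2) partial_cong_open[OF assms(1) _ d assms(3)]
    by (auto simp: C1_on_def cong: continuous_on_cong)
  ultimately show ?thesis by (auto simp: C1_on_def)
qed

lemma partial_compose:
  fixes G :: "real^'m::finite \<Rightarrow> 'b::real_normed_vector" and \<theta> :: "real^'k::finite \<Rightarrow> real^'m"
  assumes "\<theta> differentiable (at x)" "G differentiable (at (\<theta> x))"
  shows "partial a (G \<circ> \<theta>) x = (\<Sum>b\<in>UNIV. (partial a \<theta> x $ b) *\<^sub>R partial b G (\<theta> x))"
proof -
  let ?D = "frechet_derivative G (at (\<theta> x))"
  have lin: "linear ?D" using assms(2) by (rule linear_frechet_derivative)
  have "partial a (G \<circ> \<theta>) x = ?D (partial a \<theta> x)"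
    unfolding partial_def by (simp add: frechet_derivative_compose assms)
  also have "partial a \<theta> x = (\<Sum>b\<in>UNIV. (partial a \<theta> x $ b) *\<^sub>R axis b 1)"
    by (simp add: basis_expansion flip: scalar_mult_eq_scaleR)
  also have "?D \<dots> = (\<Sum>b\<in>UNIV. (partial a \<theta> x $ b) *\<^sub>R ?D (axis b 1))"
    by (simp add: linear_sum[OF lin] linear_cmul[OF lin])
  finally show ?thesis by (simp add: partial_def o_def)
qed

lemma C1_on_compose:
  fixes G :: "real^'m::finite \<Rightarrow> 'b::real_normed_vector" and \<theta> :: "real^'k::finite \<Rightarrow> real^'m"
  assumes "C1_on S \<theta>" "C1_on T G" "\<theta> ` S \<subseteq> T"
  shows "C1_on S (G \<circ> \<theta>)"
proof -
  have d: "\<theta> differentiable (at x)" "G differentiable (at (\<theta> x))" if "x \<in> S" for x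
    using assms that by (auto simp: C1_on_def)
  have c: "continuous_on S (\<lambda>x. partial b G (\<theta> x))" for b
    using assms(2,3) continuous_on_compose2[OF _ C1_on_imp_continuous_on[OF assms(1)], of T "partial b G"]
    by (auto simp: C1_on_def)
  have "continuous_on S (partial a (G \<circ> \<theta>))" for a
  proof -
    have "continuous_on S (\<lambda>x. \<Sum>b\<in>UNIV. (partial a \<theta> x $ b) *\<^sub>R partial b G (\<theta> x))"
      using assms(1) c unfolding C1_on_def by (intro continuous_intros) auto
    then show ?thesis using d by (simp add: partial_compose cong: continuous_on_cong)
  qed
  then show ?thesis using d by (auto simp: C1_on_def differentiable_chain_at)
qed

text \<open>The maximum makes the density nonnegative without an appeal to the nonnegativity of Gram
  determinants; it does not change the value as an extended nonnegative real.\<close>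

definition vol_density :: "(real^'m::finite \<Rightarrow> real^'n::finite) \<Rightarrow> real^'m \<Rightarrow> real"
  where "vol_density F x = max 0 (sqrt (det (metric F x)))"

lemma vol_density_nonneg [simp]: "vol_density F x \<ge> 0"
  by (simp add: vol_density_def)

lemma ennreal_vol_density: "ennreal (sqrt (det (metric F x))) = ennreal (vol_density F x)"
  by (simp add: vol_density_def max_def ennreal_neg)

lemma continuous_on_vol_density:
  assumes "C1_on S F" shows "continuous_on S (vol_density F)"
  using assms unfolding vol_density_def C1_on_def det_def metric_def
  by (auto intro!: continuous_intros)

lemma vol_density_cong_open:
  assumes "open S" "x \<in> S" "F differentiable (at x)" "\<And>x. x \<in> S \<Longrightarrow> F x = G x"
  shows "vol_density F x = vol_density G x"
  unfolding vol_density_def metric_def using partial_cong_open[OF assms] by simp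

text \<open>By the chain rule the Gram matrix becomes J^T g J, with J the Jacobian matrix of
  \<open>\<theta>\<close>. Its determinant gains the factor (det J)^2, whose square root is the
  absolute value of det J.\<close>

lemma vol_density_compose:
  fixes G :: "real^'m::finite \<Rightarrow> real^'n::finite" and \<theta> :: "real^'m \<Rightarrow> real^'m"
  assumes "\<theta> differentiable (at x)" "G differentiable (at (\<theta> x))"
  shows "vol_density (G \<circ> \<theta>) x =
    \<bar>det (matrix (frechet_derivative \<theta> (at x)))\<bar> * vol_density G (\<theta> x)"
proof -
  let ?J = "matrix (frechet_derivative \<theta> (at x))"
  have J: "?J $ b $ a = partial a \<theta> x $ b" for a b by (simp add: matrix_def partial_def)
  have "metric (G \<circ> \<theta>) x = transpose ?J ** metric G (\<theta> x) ** ?J"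
    by (simp add: vec_eq_iff metric_def partial_compose[OF assms] matrix_matrix_mult_def transpose_def J
      inner_sum_left inner_sum_right sum_distrib_left sum_distrib_right mult_ac)
  then have "det (metric (G \<circ> \<theta>) x) = (det ?J)\<^sup>2 * det (metric G (\<theta> x))"
    by (simp add: det_mul det_transpose power2_eq_square mult_ac)
  then show ?thesis
    by (simp add: vol_density_def real_sqrt_mult max_mult_distrib_left)
qed

text \<open>The Jacobian factor from the change of variables is exactly the one by which the density
  of \<open>G\<close> turns into that of the composite; this is the invariance behind the volume
  measure.\<close>

lemma nn_integral_vol_density_image:
  fixes G :: "real^'m::finite \<Rightarrow> real^'n::finite" and \<theta> :: "real^'m \<Rightarrow> real^'m"
  assumes S: "C1_on S \<theta>" "inj_on \<theta> S" and T: "C1_on T G" "\<theta> ` S \<subseteq> T"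
    and E: "E \<subseteq> S" "E \<in> sets borel" "\<theta> ` E \<in> sets borel"
  shows "(\<integral>\<^sup>+y\<in>\<theta> ` E. ennreal (vol_density G y) \<partial>lborel) =
    (\<integral>\<^sup>+x\<in>E. ennreal (vol_density (G \<circ> \<theta>) x) \<partial>lborel)"
proof -
  let ?d = "\<lambda>x. frechet_derivative \<theta> (at x)"
  have d: "\<theta> differentiable (at x)" "G differentiable (at (\<theta> x))" if "x \<in> S" for x
    using assms that by (auto simp: C1_on_def)
  have "(\<integral>\<^sup>+y\<in>\<theta> ` E. ennreal (vol_density G y) \<partial>lborel) =
    (\<integral>\<^sup>+x\<in>E. ennreal (\<bar>det (matrix (?d x))\<bar> * vol_density G (\<theta> x)) \<partial>lborel)"
  proof (rule nn_integral_change_of_variables)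
    show "(\<theta> has_derivative ?d x) (at x within E)" if "x \<in> E" for x
      using d(1)[of x] that E(1) by (auto simp: frechet_derivative_works intro: has_derivative_at_withinI)
    show "inj_on \<theta> E" using S(2) E(1) by (rule inj_on_subset)
    have "continuous_on (\<theta> ` E) (vol_density G)"
      using continuous_on_vol_density[OF T(1)] T(2) E(1) by (blast intro: continuous_on_subset)
    then show "(\<lambda>y. indicator (\<theta> ` E) y * vol_density G y) \<in> borel_measurable borel"
      using borel_measurable_continuous_on_indicator[OF E(3), of "vol_density G"] by simp
    \<comment> \<open>Measurability of the transformed integrand comes from recognising it on
      \<open>E\<close> as the continuous density of the composite.\<close>
    have "continuous_on E (vol_density (G \<circ> \<theta>))"
      using continuous_on_vol_density[OF C1_on_compose[OF S(1) T]] E(1) by (blast intro: continuous_on_subset)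
    then have "(\<lambda>x. indicator E x * vol_density (G \<circ> \<theta>) x) \<in> borel_measurable borel"
      using borel_measurable_continuous_on_indicator[OF E(2), of "vol_density (G \<circ> \<theta>)"] by simp
    also have "(\<lambda>x. indicator E x * vol_density (G \<circ> \<theta>) x) =
        (\<lambda>x. indicator E x * (\<bar>det (matrix (?d x))\<bar> * vol_density G (\<theta> x)))"
      using E(1) by (auto simp: fun_eq_iff vol_density_compose[OF d] split: split_indicator)
    finally show "(\<lambda>x. indicator E x * (\<bar>det (matrix (?d x))\<bar> * vol_density G (\<theta> x))) \<in> borel_measurable borel" .
  qed (use E in auto)
  also have "\<dots> = (\<integral>\<^sup>+x\<in>E. ennreal (vol_density (G \<circ> \<theta>) x) \<partial>lborel)"
    using E(1) by (intro nn_integral_cong) (auto simp: vol_density_compose[OF d] split: split_indicator)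
  finally show ?thesis .
qed

section \<open>Charts compatible with an atlas\<close>

text \<open>Charts outside the atlas are needed because a diffeomorphism carries the charts of one manifold
  to compatible charts of the other, not to members of its atlas.\<close>

definition compatible_chart :: "('a, 'm::finite) manifold \<Rightarrow> ('a, 'm) chart \<Rightarrow> bool"
  where "compatible_chart N c \<longleftrightarrow>
    openin (mtop N) (fst c) \<and> open (snd c ` fst c) \<and>
    homeomorphic_map (subtopology (mtop N) (fst c)) (top_of_set (snd c ` fst c)) (snd c) \<and>
    (\<forall>d\<in>atlas N. C1_on (snd c ` (fst c \<inter> fst d)) (in_chart (snd d) c))"

definition C1_map :: "('a, 'm::finite) manifold \<Rightarrow> ('a \<Rightarrow> 'b::real_normed_vector) \<Rightarrow> bool"
  where "C1_map N f \<longleftrightarrow> (\<forall>c\<in>atlas N. C1_on (snd c ` fst c) (in_chart f c))"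

text \<open>This names, as a measure space, the sigma-algebra prescribed in the characterisation of
  \<open>volume_measure\<close>.\<close>

definition borel_sigma :: "('a, 'm::finite) manifold \<Rightarrow> 'a measure"
  where "borel_sigma N = sigma (carrier N) {W. openin (mtop N) W}"

lemma open_subset_Pow: "{W. openin X W} \<subseteq> Pow (topspace X)"
  using openin_subset by auto

lemma space_borel_sigma [simp]: "space (borel_sigma N) = carrier N"
  by (simp add: borel_sigma_def open_subset_Pow space_measure_of)

lemma sets_borel_sigma: "sets (borel_sigma N) = sigma_sets (carrier N) {W. openin (mtop N) W}"
  by (simp add: borel_sigma_def open_subset_Pow sets_measure_of)

lemma borel_sigma_open [intro]: "openin (mtop N) W \<Longrightarrow> W \<in> sets (borel_sigma N)"
  by (simp add: sets_borel_sigma sigma_sets.Basic)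

lemma smooth_immersion_imp_C1_map: "smooth_immersion N f \<Longrightarrow> C1_map N f"
  by (auto simp: smooth_immersion_def C1_map_def intro: smooth_on_imp_C1_on)

lemma atlas_imp_compatible_chart:
  assumes "smooth_manifold N" "c \<in> atlas N"
  shows "compatible_chart N c"
  using assms unfolding smooth_manifold_def compatible_chart_def
  by (force intro: smooth_on_imp_C1_on simp: case_prod_beta)

text \<open>The empty chart serves as padding when an atlas is enumerated by the naturals.\<close>

lemma empty_compatible_chart: "compatible_chart N ({}, \<xi>)"
  by (auto simp: compatible_chart_def C1_on_def homeomorphic_map_def quotient_map_def)

lemma
  assumes "compatible_chart N c"
  shows compatible_chart_inj: "inj_on (snd c) (fst c)"
    and compatible_chart_subset: "fst c \<subseteq> carrier N"
    and compatible_chart_open_image: "\<And>W. openin (mtop N) W \<Longrightarrow> W \<subseteq> fst c \<Longrightarrow> open (snd c ` W)"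
    and compatible_chart_open_vimage: "\<And>D. open D \<Longrightarrow> openin (mtop N) {p \<in> fst c. snd c p \<in> D}"
    and compatible_chart_borel_fst: "fst c \<in> sets (borel_sigma N)"
proof -
  have o: "openin (mtop N) (fst c)" "open (snd c ` fst c)"
    and h: "homeomorphic_map (subtopology (mtop N) (fst c)) (top_of_set (snd c ` fst c)) (snd c)"
    using assms by (auto simp: compatible_chart_def)
  show s: "fst c \<subseteq> carrier N" using o by (simp add: openin_subset)
  then have ts: "topspace (subtopology (mtop N) (fst c)) = fst c" by auto
  show "inj_on (snd c) (fst c)" using homeomorphic_imp_injective_map[OF h] ts by simp
  show "open (snd c ` W)" if "openin (mtop N) W" "W \<subseteq> fst c" for W
  proof -
    have "openin (subtopology (mtop N) (fst c)) W"
      using that o by (simp add: openin_open_subtopology)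
    then have "openin (top_of_set (snd c ` fst c)) (snd c ` W)"
      using homeomorphic_imp_open_map[OF h] by (simp add: open_map_def)
    then show ?thesis using o by (simp add: openin_open_eq)
  qed
  show "openin (mtop N) {p \<in> fst c. snd c p \<in> D}" if "open D" for D
  proof -
    have "openin (top_of_set (snd c ` fst c)) (snd c ` fst c \<inter> D)"
      using that by (simp add: openin_open_Int)
    then have "openin (subtopology (mtop N) (fst c)) {p \<in> fst c. snd c p \<in> snd c ` fst c \<inter> D}"
      using homeomorphic_imp_continuous_map[OF h] ts unfolding continuous_map_def by force
    moreover have "{p \<in> fst c. snd c p \<in> snd c ` fst c \<inter> D} = {p \<in> fst c. snd c p \<in> D}" by auto
    ultimately show ?thesis using o by (simp add: openin_open_subtopology)
  qed
  show "fst c \<in> sets (borel_sigma N)" using o by auto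
qed

section \<open>Borel sets and C1 maps seen in compatible charts\<close>

lemma in_chart_apply:
  assumes "compatible_chart N c" "p \<in> fst c"
  shows "in_chart h c (snd c p) = h p"
  by (simp add: in_chart_def inv_into_f_f[OF compatible_chart_inj[OF assms(1)] assms(2)])

text \<open>The sets whose part inside the chart has a Borel image contain the open sets and form a
  sigma-algebra; injectivity of the chart gives closure under complements.\<close>

lemma compatible_chart_borel_image:
  assumes c: "compatible_chart N c" and "E \<in> sets (borel_sigma N)" "E \<subseteq> fst c"
  shows "snd c ` E \<in> sets borel"
proof -
  have "snd c ` (E \<inter> fst c) \<in> sets borel"
    using assms(2) unfolding sets_borel_sigma
  proof induction
    case (Basic W)
    then have "openin (mtop N) (W \<inter> fst c)" using c by (auto simp: compatible_chart_def)
    then show ?case using compatible_chart_open_image[OF c] by auto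
  next
    case (Compl E)
    have "snd c ` ((carrier N - E) \<inter> fst c) = snd c ` fst c - snd c ` (E \<inter> fst c)"
      using compatible_chart_inj[OF c] compatible_chart_subset[OF c] by (auto dest: inj_onD)
    moreover have "open (snd c ` fst c)" using c by (simp add: compatible_chart_def)
    ultimately show ?case using Compl by auto
  next
    case (Union E)
    have "snd c ` ((\<Union>i. E i) \<inter> fst c) = (\<Union>i. snd c ` (E i \<inter> fst c))" by auto
    then show ?case using Union by auto
  qed auto
  then show ?thesis using assms(3) by (simp add: Int_absorb2)
qed

lemma compatible_chart_measurable:
  assumes c: "compatible_chart N c"
  shows "snd c \<in> restrict_space (borel_sigma N) (fst c) \<rightarrow>\<^sub>M borel"
proof (rule borel_measurableI)
  fix D :: "(real^'b) set" assume "open D"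
  then have "openin (mtop N) {p \<in> fst c. snd c p \<in> D}" by (rule compatible_chart_open_vimage[OF c])
  moreover have "snd c -` D \<inter> space (restrict_space (borel_sigma N) (fst c)) = {p \<in> fst c. snd c p \<in> D}"
    using compatible_chart_subset[OF c] by (auto simp: space_restrict_space)
  ultimately show "snd c -` D \<inter> space (restrict_space (borel_sigma N) (fst c)) \<in> sets (restrict_space (borel_sigma N) (fst c))"
    using compatible_chart_borel_fst[OF c]  compatible_chart_subset[OF c]
    by (auto simp: sets_restrict_space_iff Int_absorb2)
qed

text \<open>On the overlap with an atlas chart, the representation of \<open>f\<close> is its
  representation in that atlas chart after a C1 transition map. These overlaps are open and cover
  the domain, and being C1 is local.\<close>

lemma C1_map_in_compatible_chart:
  assumes N: "smooth_manifold N" "C1_map N f" and c: "compatible_chart N c"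
  shows "C1_on (snd c ` fst c) (in_chart f c)"
proof -
  have loc: "C1_on (snd c ` (fst c \<inter> fst d)) (in_chart f c)" "open (snd c ` (fst c \<inter> fst d))"
    if d: "d \<in> atlas N" for d
  proof -
    have d': "compatible_chart N d" using N(1) d by (rule atlas_imp_compatible_chart)
    show o: "open (snd c ` (fst c \<inter> fst d))"
      using compatible_chart_open_image[OF c] c d' by (auto simp: compatible_chart_def)
    have "C1_on (snd c ` (fst c \<inter> fst d)) (in_chart f d \<circ> in_chart (snd d) c)"
      using c d N(2) by (intro C1_on_compose[where T = "snd d ` fst d"])
        (auto simp: compatible_chart_def C1_map_def in_chart_apply[OF c])
    then show "C1_on (snd c ` (fst c \<inter> fst d)) (in_chart f c)"
      by (rule C1_on_cong[OF o]) (auto simp: in_chart_apply[OF c] in_chart_apply[OF d'])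
  qed
  have cov: "\<exists>d\<in>atlas N. x \<in> snd c ` (fst c \<inter> fst d)" if "x \<in> snd c ` fst c" for x
  proof -
    from that obtain p where p: "p \<in> fst c" "x = snd c p" by auto
    then have "p \<in> (\<Union>d\<in>atlas N. fst d)"
      using compatible_chart_subset[OF c] N(1) by (auto simp: smooth_manifold_def)
    with p show ?thesis by auto
  qed
  show ?thesis
    unfolding C1_on_def
  proof (intro conjI ballI allI continuous_at_imp_continuous_on)
    fix x assume x: "x \<in> snd c ` fst c"
    from cov[OF x] obtain d where d: "d \<in> atlas N" "x \<in> snd c ` (fst c \<inter> fst d)" by auto
    show "in_chart f c differentiable at x" using loc(1)[OF d(1)] d(2) unfolding C1_on_def by blast
    show "isCont (partial a (in_chart f c)) x" for a
      using loc[OF d(1)] d(2) by (auto simp: C1_on_def continuous_on_eq_continuous_at)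
  qed
qed

lemma C1_map_open_vimage:
  fixes f :: "'a \<Rightarrow> 'c::real_normed_vector"
  assumes N: "smooth_manifold N" "C1_map N f" and D: "open D"
  shows "openin (mtop N) {p \<in> carrier N. f p \<in> D}"
proof -
  have "openin (mtop N) {p \<in> fst c. f p \<in> D}" if c: "c \<in> atlas N" for c
  proof -
    have c': "compatible_chart N c" using N(1) c by (rule atlas_imp_compatible_chart)
    have "continuous_on (snd c ` fst c) (in_chart f c)"
      using N(2) c by (auto simp: C1_map_def intro: C1_on_imp_continuous_on)
    then have "open (in_chart f c -` D \<inter> snd c ` fst c)"
      using D c' by (auto simp: continuous_on_open_vimage compatible_chart_def)
    then have "openin (mtop N) {p \<in> fst c. snd c p \<in> in_chart f c -` D \<inter> snd c ` fst c}"
      by (rule compatible_chart_open_vimage[OF c'])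
    also have "{p \<in> fst c. snd c p \<in> in_chart f c -` D \<inter> snd c ` fst c} = {p \<in> fst c. f p \<in> D}"
      by (auto simp: in_chart_apply[OF c'] dest: inj_onD[OF compatible_chart_inj[OF c']])
    finally show ?thesis .
  qed
  then have "openin (mtop N) (\<Union>c\<in>atlas N. {p \<in> fst c. f p \<in> D})" by blast
  also have "(\<Union>c\<in>atlas N. {p \<in> fst c. f p \<in> D}) = {p \<in> carrier N. f p \<in> D}"
    using N(1) by (auto simp: smooth_manifold_def)
  finally show ?thesis .
qed

lemma C1_map_measurable:
  assumes "smooth_manifold N" "C1_map N f"
  shows "f \<in> borel_sigma N \<rightarrow>\<^sub>M borel"
proof (rule borel_measurableI)
  fix D :: "'c set" assume "open D"
  then have "openin (mtop N) {p \<in> carrier N. f p \<in> D}" by (rule C1_map_open_vimage[OF assms])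
  also have "{p \<in> carrier N. f p \<in> D} = f -` D \<inter> space (borel_sigma N)" by auto
  finally show "f -` D \<inter> space (borel_sigma N) \<in> sets (borel_sigma N)" by auto
qed

section \<open>Masses of Borel sets computed in a single chart\<close>

definition chart_mass :: "('a \<Rightarrow> real^'n::finite) \<Rightarrow> ('a, 'm::finite) chart \<Rightarrow> 'a set \<Rightarrow> ennreal"
  where "chart_mass f c E = (\<integral>\<^sup>+x\<in>snd c ` E. ennreal (vol_density (in_chart f c) x) \<partial>lborel)"

lemma chart_mass_empty [simp]: "chart_mass f c {} = 0"
  by (simp add: chart_mass_def)

text \<open>The transition map is an injective C1 change of variables between the two images of
  \<open>E\<close>, and it carries one density into the other.\<close>

lemma chart_mass_overlap:
  assumes N: "smooth_manifold N" "C1_map N f" and c: "compatible_chart N c" and d: "d \<in> atlas N"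
    and E: "E \<in> sets (borel_sigma N)" "E \<subseteq> fst c" "E \<subseteq> fst d"
  shows "chart_mass f d E = chart_mass f c E"
proof -
  have d': "compatible_chart N d" using N(1) d by (rule atlas_imp_compatible_chart)
  let ?S = "snd c ` (fst c \<inter> fst d)" and ?th = "in_chart (snd d) c"
  have o: "open ?S"
    using compatible_chart_open_image[OF c] c d' by (auto simp: compatible_chart_def)
  have im: "?th ` snd c ` E = snd d ` E"
    using E(2) by (auto simp: image_image in_chart_apply[OF c] subset_iff intro!: image_cong)
  have eq: "in_chart f c x = (in_chart f d \<circ> ?th) x" if "x \<in> ?S" for x
    using that by (auto simp: in_chart_apply[OF c] in_chart_apply[OF d'])
  have diff: "in_chart f c differentiable (at x)" if "x \<in> ?S" for x
    using C1_map_in_compatible_chart[OF N c] that by (auto simp: C1_on_def)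
  have dens: "vol_density (in_chart f c) x = vol_density (in_chart f d \<circ> ?th) x" if "x \<in> ?S" for x
    by (rule vol_density_cong_open[OF o that diff[OF that] eq])
  have "chart_mass f d E = (\<integral>\<^sup>+y\<in>?th ` snd c ` E. ennreal (vol_density (in_chart f d) y) \<partial>lborel)"
    by (simp add: chart_mass_def im)
  also have "\<dots> = (\<integral>\<^sup>+x\<in>snd c ` E. ennreal (vol_density (in_chart f d \<circ> ?th) x) \<partial>lborel)"
  proof (rule nn_integral_vol_density_image)
    show "C1_on ?S ?th" using c d by (simp add: compatible_chart_def)
    show "inj_on ?th ?S"
      using compatible_chart_inj[OF d'] by (auto simp: inj_on_def in_chart_apply[OF c])
    show "C1_on (snd d ` fst d) (in_chart f d)" using N d by (simp add: C1_map_def)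
    show "?th ` ?S \<subseteq> snd d ` fst d" by (auto simp: in_chart_apply[OF c])
    show "snd c ` E \<subseteq> ?S" using E by auto
    show "snd c ` E \<in> sets borel" by (rule compatible_chart_borel_image[OF c E(1,2)])
    show "?th ` snd c ` E \<in> sets borel"
      unfolding im by (rule compatible_chart_borel_image[OF d' E(1,3)])
  qed
  also have "\<dots> = chart_mass f c E"
    unfolding chart_mass_def using E by (intro nn_integral_cong) (auto intro!: dens[symmetric] split: split_indicator)
  finally show ?thesis .
qed

lemma chart_mass_suminf:
  assumes N: "smooth_manifold N" "C1_map N f" and c: "compatible_chart N c"
    and E: "\<And>i::nat. E i \<in> sets (borel_sigma N)" "\<And>i. E i \<subseteq> fst c" "disjoint_family E"
  shows "(\<Sum>i. chart_mass f c (E i)) = chart_mass f c (\<Union>i. E i)"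
proof -
  let ?U = "snd c ` fst c"
  \<comment> \<open>Continuity of the density is available only on the chart image, so it is
    extended by zero to a Borel function on the whole space.\<close>
  let ?v = "\<lambda>x. ennreal (indicator ?U x * vol_density (in_chart f c) x)"
  have o: "open ?U" using c by (simp add: compatible_chart_def)
  have "continuous_on ?U (vol_density (in_chart f c))"
    by (rule continuous_on_vol_density[OF C1_map_in_compatible_chart[OF N c]])
  then have "(\<lambda>x. indicator ?U x * vol_density (in_chart f c) x) \<in> borel_measurable borel"
    using borel_measurable_continuous_on_indicator[of ?U "vol_density (in_chart f c)"] o by simp
  then have v: "?v \<in> borel_measurable lborel" by simp
  have cm: "chart_mass f c A = (\<integral>\<^sup>+x\<in>snd c ` A. ?v x \<partial>lborel)" if "A \<subseteq> fst c" for A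
    unfolding chart_mass_def using that by (intro nn_integral_cong) (auto split: split_indicator)
  have dis: "disjoint_family (\<lambda>i. snd c ` E i)"
    using E(2,3) compatible_chart_inj[OF c] unfolding disjoint_family_on_def inj_on_def by fast
  have "(\<Sum>i. chart_mass f c (E i)) = (\<Sum>i. (\<integral>\<^sup>+x\<in>snd c ` E i. ?v x \<partial>lborel))"
    using cm E(2) by simp
  also have "\<dots> = (\<integral>\<^sup>+x\<in>(\<Union>i. snd c ` E i). ?v x \<partial>lborel)"
    using compatible_chart_borel_image[OF c E(1,2)] dis
    by (intro nn_integral_disjoint_family[OF v, symmetric]) auto
  also have "\<dots> = chart_mass f c (\<Union>i. E i)"
    using E(2) by (subst cm) (auto simp: image_UN)
  finally show ?thesis .
qed

text \<open>Second countability gives a countable subatlas, whose domains are then made disjoint.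
  Membership of \<open>c n\<close> in the atlas is claimed only for nonempty pieces, because the
  enumeration contains the empty padding chart.\<close>

lemma countable_chart_partition:
  fixes N :: "('a, 'm::finite) manifold"
  assumes N: "smooth_manifold N"
  obtains c :: "nat \<Rightarrow> ('a, 'm) chart" and D :: "nat \<Rightarrow> 'a set" where
    "\<And>n. D n \<noteq> {} \<Longrightarrow> c n \<in> atlas N" "\<And>n. compatible_chart N (c n)"
    "\<And>n. D n \<subseteq> fst (c n)" "\<And>n. D n \<in> sets (borel_sigma N)"
    "disjoint_family D" "(\<Union>n. D n) = carrier N"
proof -
  have "Lindelof_space (mtop N)"
    using N by (simp add: smooth_manifold_def second_countable_imp_Lindelof_space)
  moreover have "\<forall>U\<in>fst ` atlas N. openin (mtop N) U" and cov: "\<Union>(fst ` atlas N) = carrier N"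
    using N by (auto simp: smooth_manifold_def)
  ultimately obtain V where V: "countable V" "V \<subseteq> fst ` atlas N" "\<Union>V = carrier N"
    unfolding Lindelof_space_def by (smt (verit) imageE)
  then obtain A where A: "countable A" "A \<subseteq> atlas N" "V = fst ` A"
    by (metis countable_subset_image)
  \<comment> \<open>Inserting the empty chart makes the set nonempty, so that the enumeration has
    exactly this set as its range even for an empty atlas.\<close>
  define c where "c = from_nat_into (insert ({}, undefined) A)"
  have range: "range c = insert ({}, undefined) A"
    unfolding c_def using A(1) by (intro range_from_nat_into) auto
  then have cA: "c n = ({}, undefined) \<or> c n \<in> atlas N" for n using A(2) by blast
  have comp: "compatible_chart N (c n)" for n
    using cA[of n] atlas_imp_compatible_chart[OF N] empty_compatible_chart by metis
  show ?thesis
  proof (rule that[where c = c and D = "disjointed (\<lambda>n. fst (c n))"])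
    show sub: "disjointed (\<lambda>n. fst (c n)) n \<subseteq> fst (c n)" for n by (rule disjointed_subset)
    show "c n \<in> atlas N" if "disjointed (\<lambda>n. fst (c n)) n \<noteq> {}" for n
      using cA[of n] sub[of n] that by auto
    show "disjointed (\<lambda>n. fst (c n)) n \<in> sets (borel_sigma N)" for n
      using sets.range_disjointed_sets[of "\<lambda>n. fst (c n)"] compatible_chart_borel_fst[OF comp] by auto
    have "(\<Union>n. fst (c n)) = \<Union>(fst ` range c)" by auto
    also have "\<dots> = carrier N" using V(3) A(3) by (simp add: range)
    finally show "(\<Union>n. disjointed (\<lambda>n. fst (c n)) n) = carrier N" by (simp add: UN_disjointed_eq)
  qed (use comp disjoint_family_disjointed in auto)
qed

section \<open>The volume measure\<close>

text \<open>This shows that the definite description defining \<open>volume_measure\<close> denotes.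
  Existence: sum the chart masses over a countable Borel partition subordinate to charts.
  Uniqueness: the prescribed values on the pieces determine the measure.\<close>

lemma
  assumes N: "smooth_manifold N" "C1_map N f"
  shows sets_volume_measure: "sets (volume_measure N f) = sets (borel_sigma N)"
    and emeasure_volume_measure: "\<And>c E. compatible_chart N c \<Longrightarrow> E \<in> sets (borel_sigma N) \<Longrightarrow>
      E \<subseteq> fst c \<Longrightarrow> emeasure (volume_measure N f) E = chart_mass f c E"
proof -
  obtain c D where cD: "\<And>n::nat. D n \<noteq> {} \<Longrightarrow> c n \<in> atlas N" "\<And>n. compatible_chart N (c n)"
    "\<And>n. D n \<subseteq> fst (c n)" "\<And>n. D n \<in> sets (borel_sigma N)"
    "disjoint_family D" "(\<Union>n. D n) = carrier N"
    using countable_chart_partition[OF N(1)] by metis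
  define m where "m E = (\<Sum>n. chart_mass f (c n) (E \<inter> D n))" for E
  have ED: "E \<inter> D n \<in> sets (borel_sigma N)" "E \<inter> D n \<subseteq> fst (c n)"
    if "E \<in> sets (borel_sigma N)" for E n using that cD(3,4) by auto
  have disj: "disjoint_family (\<lambda>n. E \<inter> D n)" for E
    using cD(5) by (auto simp: disjoint_family_on_def)
  have UN: "(\<Union>n. E \<inter> D n) = E" if "E \<in> sets (borel_sigma N)" for E
    using sets.sets_into_space[OF that] cD(6) by auto
  \<comment> \<open>On each piece the mass may be computed in \<open>d\<close> instead of
    \<open>c n\<close>, by invariance on overlaps; additivity in \<open>d\<close> then reassembles
    \<open>E\<close>.\<close>
  have m_chart: "m E = chart_mass f d E"
    if d: "compatible_chart N d" and E: "E \<in> sets (borel_sigma N)" "E \<subseteq> fst d" for d E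
  proof -
    have "chart_mass f (c n) (E \<inter> D n) = chart_mass f d (E \<inter> D n)" for n
    proof (cases "D n = {}")
      case False
      then show ?thesis
        using chart_mass_overlap[OF N d cD(1)[OF False] ED(1)[OF E(1)] _ ED(2)[OF E(1)]] E(2) by blast
    qed simp
    then have "m E = (\<Sum>n. chart_mass f d (E \<inter> D n))" by (simp add: m_def)
    also have "\<dots> = chart_mass f d (\<Union>n. E \<inter> D n)"
      using ED[OF E(1)] disj E(2) by (intro chart_mass_suminf[OF N d]) auto
    finally show ?thesis by (simp only: UN[OF E(1)])
  qed
  define \<nu> where "\<nu> = measure_of (carrier N) (sets (borel_sigma N)) m"
  have sets_\<nu>: "sets \<nu> = sets (borel_sigma N)"
    using sets.sigma_sets_eq[of "borel_sigma N"] sets.space_closed[of "borel_sigma N"]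
    by (simp add: \<nu>_def sets_measure_of)
  have ems: "emeasure \<nu> E = m E" if "E \<in> sets (borel_sigma N)" for E
    unfolding \<nu>_def
  proof (rule emeasure_measure_of_sigma)
    show "sigma_algebra (carrier N) (sets (borel_sigma N))"
      using sets.sigma_algebra_axioms[of "borel_sigma N"] by simp
    show "positive (sets (borel_sigma N)) m" by (simp add: positive_def m_def)
    show "countably_additive (sets (borel_sigma N)) m"
    proof (rule countably_additiveI)
      fix A :: "nat \<Rightarrow> 'a set"
      assume A: "range A \<subseteq> sets (borel_sigma N)" "disjoint_family A"
      \<comment> \<open>The sum over the pieces is read as an integral over counting measure, which
        allows the two infinite sums to be interchanged.\<close>
      have "(\<Sum>i. m (A i)) = (\<Sum>i. \<integral>\<^sup>+n. chart_mass f (c n) (A i \<inter> D n) \<partial>count_space UNIV)"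
        by (simp add: m_def nn_integral_count_space_nat)
      also have "\<dots> = (\<integral>\<^sup>+n. (\<Sum>i. chart_mass f (c n) (A i \<inter> D n)) \<partial>count_space UNIV)"
        by (rule nn_integral_suminf[symmetric]) simp
      also have "\<dots> = (\<Sum>n. \<Sum>i. chart_mass f (c n) (A i \<inter> D n))"
        by (simp add: nn_integral_count_space_nat)
      also have "\<dots> = (\<Sum>n. chart_mass f (c n) (\<Union>i. A i \<inter> D n))"
      proof (intro suminf_cong chart_mass_suminf[OF N cD(2)])
        show "disjoint_family (\<lambda>i. A i \<inter> D n)" for n using A(2) by (auto simp: disjoint_family_on_def)
      qed (use A ED in auto)
      also have "\<dots> = m (\<Union>i. A i)" by (simp add: m_def)
      finally show "(\<Sum>i. m (A i)) = m (\<Union>i. A i)" .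
    qed
  qed (use that in \<open>auto\<close>)
  let ?P = "\<lambda>\<nu>. sets \<nu> = sigma_sets (carrier N) {W. openin (mtop N) W} \<and>
    (\<forall>(U, \<xi>)\<in>atlas N. \<forall>E\<in>sets \<nu>. E \<subseteq> U \<longrightarrow> emeasure \<nu> E =
        (\<integral>\<^sup>+x\<in>\<xi> ` E. ennreal (sqrt (det (metric (in_chart f (U, \<xi>)) x))) \<partial>lborel))"
  have P_iff: "?P \<nu>' \<longleftrightarrow> sets \<nu>' = sets (borel_sigma N) \<and>
    (\<forall>c\<in>atlas N. \<forall>E\<in>sets \<nu>'. E \<subseteq> fst c \<longrightarrow> emeasure \<nu>' E = chart_mass f c E)" for \<nu>'
    by (simp add: sets_borel_sigma ennreal_vol_density chart_mass_def case_prod_beta)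
  have "volume_measure N f = \<nu>"
    unfolding volume_measure_def
  proof (rule the_equality)
    have "\<forall>c\<in>atlas N. \<forall>E\<in>sets \<nu>. E \<subseteq> fst c \<longrightarrow> emeasure \<nu> E = chart_mass f c E"
      unfolding sets_\<nu> using ems m_chart atlas_imp_compatible_chart[OF N(1)] by auto
    with sets_\<nu> show "?P \<nu>" unfolding P_iff by blast
    show "\<nu>' = \<nu>" if "?P \<nu>'" for \<nu>'
    proof (rule measure_eqI)
      have \<nu>': "sets \<nu>' = sets (borel_sigma N)"
        "\<And>c E. c \<in> atlas N \<Longrightarrow> E\<in>sets (borel_sigma N) \<Longrightarrow> E \<subseteq> fst c \<Longrightarrow> emeasure \<nu>' E = chart_mass f c E"
        using that unfolding P_iff by auto
      show "sets \<nu>' = sets \<nu>" by (simp add: \<nu>'(1) sets_\<nu>)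
      fix E assume "E \<in> sets \<nu>'"
      then have E: "E \<in> sets (borel_sigma N)" by (simp add: \<nu>'(1))
      \<comment> \<open>If \<open>D n\<close> is empty, \<open>c n\<close> may be the padding chart,
        but then both sides vanish.\<close>
      have "emeasure \<nu>' (E \<inter> D n) = chart_mass f (c n) (E \<inter> D n)" for n
        using \<nu>'(2)[OF cD(1) ED[OF E]] by (cases "D n = {}") auto
      then have "m E = (\<Sum>n. emeasure \<nu>' (E \<inter> D n))" by (simp add: m_def)
      also have "\<dots> = emeasure \<nu>' (\<Union>n. E \<inter> D n)"
        using ED[OF E] disj by (intro suminf_emeasure) (auto simp: \<nu>'(1))
      finally show "emeasure \<nu>' E = emeasure \<nu> E" by (simp only: UN[OF E] ems[OF E])
    qed
  qed
  then show "sets (volume_measure N f) = sets (borel_sigma N)"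
    and "\<And>c E. compatible_chart N c \<Longrightarrow> E \<in> sets (borel_sigma N) \<Longrightarrow>
      E \<subseteq> fst c \<Longrightarrow> emeasure (volume_measure N f) E = chart_mass f c E"
    by (simp_all add: sets_\<nu> ems m_chart)
qed

text \<open>Pushing the volume measure on the chart domain forward to coordinates gives Lebesgue
  measure weighted by the density, so integrability and integrals transfer together.\<close>

lemma
  fixes H :: "real^'m::finite \<Rightarrow> real"
  assumes N: "smooth_manifold N" "C1_map N f" and c: "compatible_chart N c"
    and H[measurable]: "H \<in> borel_measurable borel"
  shows integrable_volume_measure_chart:
      "integrable (volume_measure N f) (\<lambda>p. indicator (fst c) p * H (snd c p)) \<longleftrightarrow>
       integrable lborel (\<lambda>x. indicator (snd c ` fst c) x * vol_density (in_chart f c) x * H x)"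
      (is ?I)
    and integral_volume_measure_chart:
      "(\<integral>p. indicator (fst c) p * H (snd c p) \<partial>volume_measure N f) =
       (\<integral>x. indicator (snd c ` fst c) x * vol_density (in_chart f c) x * H x \<partial>lborel)" (is ?E)
proof -
  let ?\<nu> = "volume_measure N f" and ?U = "fst c" and ?W = "snd c ` fst c"
  let ?v = "\<lambda>x. indicator ?W x * vol_density (in_chart f c) x"
  note s = sets_volume_measure[OF N]
  have sp: "space ?\<nu> = carrier N" using sets_eq_imp_space_eq[OF s] by simp
  have sub: "?U \<subseteq> carrier N" by (rule compatible_chart_subset[OF c])
  have U: "?U \<inter> space ?\<nu> \<in> sets ?\<nu>"
    using compatible_chart_borel_fst[OF c] sub by (simp add: s sp Int_absorb2)
  have xi[measurable]: "snd c \<in> restrict_space ?\<nu> ?U \<rightarrow>\<^sub>M borel"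
    using compatible_chart_measurable[OF c] s
    by (simp cong: measurable_cong_sets add: measurable_cong_sets[OF sets_restrict_space_cong[OF s]])
  have "continuous_on ?W (vol_density (in_chart f c))"
    by (rule continuous_on_vol_density[OF C1_map_in_compatible_chart[OF N c]])
  then have v[measurable]: "?v \<in> borel_measurable borel"
    using borel_measurable_continuous_on_indicator[of ?W "vol_density (in_chart f c)"] c
    by (simp add: compatible_chart_def)
  \<comment> \<open>Both measures assign to a Borel set the chart mass of its preimage in the chart
    domain.\<close>
  have eq: "distr (restrict_space ?\<nu> ?U) borel (snd c) = density lborel ?v"
  proof (rule measure_eqI)
    fix A assume "A \<in> sets (distr (restrict_space ?\<nu> ?U) borel (snd c))"
    then have A[measurable]: "A \<in> sets borel" by simp
    let ?E = "{p \<in> ?U. snd c p \<in> A}"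
    have vim: "snd c -` A \<inter> space (restrict_space ?\<nu> ?U) = ?E"
      using sub by (auto simp: space_restrict_space sp)
    have E: "?E \<in> sets ?\<nu>"
      using measurable_sets[OF xi A] U unfolding vim by (simp add: sets_restrict_space_iff)
    have "emeasure (distr (restrict_space ?\<nu> ?U) borel (snd c)) A = emeasure (restrict_space ?\<nu> ?U) ?E"
      by (simp add: emeasure_distr vim)
    also have "\<dots> = emeasure ?\<nu> ?E" by (rule emeasure_restrict_space[OF U]) auto
    also have "\<dots> = chart_mass f c ?E"
      using E by (intro emeasure_volume_measure[OF N c]) (auto simp: s)
    also have "\<dots> = (\<integral>\<^sup>+x. ennreal (?v x) * indicator A x \<partial>lborel)"
      unfolding chart_mass_def by (intro nn_integral_cong) (auto split: split_indicator)
    also have "\<dots> = emeasure (density lborel ?v) A" by (simp add: emeasure_density)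
    finally show "emeasure (distr (restrict_space ?\<nu> ?U) borel (snd c)) A = emeasure (density lborel ?v) A" .
  qed simp
  have "integrable ?\<nu> (\<lambda>p. indicator ?U p *\<^sub>R H (snd c p)) \<longleftrightarrow> integrable (restrict_space ?\<nu> ?U) (\<lambda>p. H (snd c p))"
    by (rule integrable_restrict_space[OF U, symmetric])
  also have "\<dots> \<longleftrightarrow> integrable (density lborel ?v) H" by (subst eq[symmetric], subst integrable_distr_eq) auto
  also have "\<dots> \<longleftrightarrow> integrable lborel (\<lambda>x. ?v x * H x)"
    by (subst integrable_density) auto
  finally show ?I by (simp add: mult.assoc)
  have "(\<integral>p. indicator ?U p *\<^sub>R H (snd c p) \<partial>?\<nu>) = (\<integral>p. H (snd c p) \<partial>restrict_space ?\<nu> ?U)"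
    by (rule integral_restrict_space[OF U, symmetric])
  also have "\<dots> = (\<integral>x. H x \<partial>density lborel ?v)" by (subst eq[symmetric], subst integral_distr) auto
  also have "\<dots> = (\<integral>x. ?v x * H x \<partial>lborel)"
    by (subst integral_density) auto
  finally show ?E by (simp add: mult.assoc)
qed

section \<open>Integrals against the image measure\<close>

lemma continuous_on_vol_density_mult:
  assumes "C1_on B F" "continuous_on UNIV \<psi>"
  shows "continuous_on B (\<lambda>x. vol_density F x * \<psi> (F x))"
  by (intro continuous_on_mult continuous_on_vol_density[OF assms(1)]
      continuous_on_compose2[OF assms(2) C1_on_imp_continuous_on[OF assms(1)]]) auto

lemma integrable_vol_density_mult:
  assumes "C1_on B F" "continuous_on UNIV (\<psi> :: _ \<Rightarrow> real)" "compact B" "A \<subseteq> B" "A \<in> sets borel"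
  shows "integrable lborel (\<lambda>x. indicator A x * (vol_density F x * \<psi> (F x)))"
proof -
  have "integrable lborel (\<lambda>x. indicator A x *\<^sub>R indicator B x *\<^sub>R (vol_density F x * \<psi> (F x)))"
    using assms(5)
    by (intro integrable_mult_indicator[OF _ borel_integrable_compact]
        continuous_on_vol_density_mult assms) simp
  also have "(\<lambda>x. indicator A x *\<^sub>R indicator B x *\<^sub>R (vol_density F x * \<psi> (F x))) =
      (\<lambda>x. indicator A x * (vol_density F x * \<psi> (F x)))"
    using assms(4) by (auto simp: fun_eq_iff split: split_indicator)
  finally show ?thesis .
qed

text \<open>Uniform convergence of the maps and their first partials on \<open>B\<close> eventually
  confines all 1-jets to one ball. A bound for the integrand there is a dominating constant,
  integrable because \<open>A\<close> has finite measure.\<close>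

lemma tendsto_integral_vol_density:
  fixes F :: "real^'m::finite \<Rightarrow> real^'n::finite" and \<psi> :: "real^'n \<Rightarrow> real"
  assumes F: "C1_on B F" "\<And>i. i \<ge> I \<Longrightarrow> C1_on B (Fs i)"
    and lim: "uniform_limit B Fs F sequentially"
      "\<And>a. uniform_limit B (\<lambda>i. partial a (Fs i)) (partial a F) sequentially"
    and \<psi>: "continuous_on UNIV \<psi>" and AB: "compact B" "A \<subseteq> B" "A \<in> sets borel"
  shows "(\<lambda>i. \<integral>x. indicator A x * (vol_density (Fs i) x * \<psi> (Fs i x)) \<partial>lborel)
    \<longlonglongrightarrow> (\<integral>x. indicator A x * (vol_density F x * \<psi> (F x)) \<partial>lborel)"
proof -
  \<comment> \<open>The integrand is a fixed continuous function \<open>\<Phi>\<close> of the 1-jet \<open>J G\<close>, hence bounded on bounded jets.\<close>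
  define \<Phi> :: "(real^'n) \<times> ((real^'n)^'m) \<Rightarrow> real"
    where "\<Phi> z = max 0 (sqrt (det (\<chi> a b. (snd z $ a) \<bullet> (snd z $ b)))) * \<psi> (fst z)" for z
  define J :: "(real^'m \<Rightarrow> real^'n) \<Rightarrow> real^'m \<Rightarrow> (real^'n) \<times> ((real^'n)^'m)"
    where "J G x = (G x, \<chi> a. partial a G x)" for G x
  have \<Phi>J: "vol_density G x * \<psi> (G x) = \<Phi> (J G x)" for G x
    by (simp add: \<Phi>_def J_def vol_density_def metric_def)
  have cont: "continuous_on UNIV \<Phi>"
    unfolding \<Phi>_def det_def
    by (auto intro!: continuous_intros continuous_on_compose2[OF \<psi>])
  have norm_J: "norm (J G x) \<le> norm (G x) + (\<Sum>a\<in>UNIV. norm (partial a G x))" for G x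
  proof -
    have "norm ((\<chi> a. partial a G x) :: (real^'n)^'m) \<le> (\<Sum>a\<in>UNIV. norm (partial a G x))"
      unfolding norm_vec_def by (rule order_trans[OF L2_set_le_sum]) auto
    then show ?thesis
      unfolding J_def using norm_Pair_le[of "G x" "(\<chi> a. partial a G x) :: (real^'n)^'m"] by linarith
  qed
  \<comment> \<open>The added ones absorb a deviation below 1 of the value and of each partial, so
    the bound \<open>b\<close> also covers the jets of all late \<open>Fs i\<close>.\<close>
  have "continuous_on B (\<lambda>x. norm (F x) + 1 + (\<Sum>a\<in>UNIV. norm (partial a F x) + 1))"
    using F(1) C1_on_imp_continuous_on[OF F(1)] by (auto intro!: continuous_intros simp: C1_on_def)
  from compact_imp_bounded[OF compact_continuous_image[OF this AB(1)]]
  obtain b where b: "\<And>x. x \<in> B \<Longrightarrow>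
      norm (norm (F x) + 1 + (\<Sum>a\<in>UNIV. norm (partial a F x) + 1)) \<le> b"
    by (auto simp: bounded_iff)
  have "compact (\<Phi> ` cball 0 b)"
    using cont by (intro compact_continuous_image) (auto intro: continuous_on_subset)
  then obtain c where "\<forall>y\<in>\<Phi> ` cball 0 b. norm y \<le> c"
    using compact_imp_bounded bounded_iff by blast
  then have c: "\<bar>\<Phi> z\<bar> \<le> c" if "norm z \<le> b" for z using that by force
  have "\<forall>\<^sub>F i in sequentially. \<forall>x\<in>B. dist (Fs i x) (F x) < 1"
    "\<forall>\<^sub>F i in sequentially. \<forall>a. \<forall>x\<in>B. dist (partial a (Fs i) x) (partial a F x) < 1"
    using uniform_limitD[OF lim(1)] uniform_limitD[OF lim(2)] by (auto intro: eventually_all_finite)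
  then have "\<forall>\<^sub>F i in sequentially. i \<ge> I \<and> (\<forall>x\<in>B. norm (J (Fs i) x) \<le> b)"
    using eventually_ge_at_top[of I]
  proof eventually_elim
    case (elim i)
    have "norm (J (Fs i) x) \<le> b" if x: "x \<in> B" for x
    proof -
      have "norm (Fs i x) \<le> norm (F x) + 1"
        using elim(1) x norm_triangle_ineq2[of "Fs i x" "F x"] by (force simp: dist_norm)
      moreover have "norm (partial a (Fs i) x) \<le> norm (partial a F x) + 1" for a
        using elim(2)[rule_format, OF x, of a] norm_triangle_ineq2[of "partial a (Fs i) x" "partial a F x"]
        by (simp add: dist_norm)
      then have "(\<Sum>a\<in>UNIV. norm (partial a (Fs i) x)) \<le> (\<Sum>a\<in>UNIV. norm (partial a F x) + 1)"
        by (intro sum_mono)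
      ultimately show ?thesis using norm_J[of "Fs i" x] b[OF x] by (auto simp: abs_le_iff)
    qed
    with elim show ?case by blast
  qed
  then obtain n where n: "\<And>i. i \<ge> n \<Longrightarrow> i \<ge> I" "\<And>i x. i \<ge> n \<Longrightarrow> x \<in> B \<Longrightarrow> norm (J (Fs i) x) \<le> b"
    by (auto simp: eventually_sequentially)
  have ptw: "(\<lambda>i. J (Fs i) x) \<longlonglongrightarrow> J F x" if "x \<in> B" for x
    unfolding J_def using lim[THEN tendsto_uniform_limitI, OF that]
    by (intro tendsto_Pair vec_tendstoI[where f = "\<lambda>i. \<chi> a. partial a (Fs i) x"]) simp_all
  \<comment> \<open>Domination must hold for every index, so the sequence is shifted past
    \<open>n\<close>; \<open>LIMSEQ_offset\<close> undoes this.\<close>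
  have "(\<lambda>i. \<integral>x. indicator A x * (vol_density (Fs (i + n)) x * \<psi> (Fs (i + n) x)) \<partial>lborel)
    \<longlonglongrightarrow> (\<integral>x. indicator A x * (vol_density F x * \<psi> (F x)) \<partial>lborel)"
  proof (rule integral_dominated_convergence[where w = "\<lambda>x. indicator A x * c"])
    show "(\<lambda>x. indicator A x * (vol_density F x * \<psi> (F x))) \<in> borel_measurable lborel"
      by (rule borel_measurable_integrable[OF integrable_vol_density_mult[OF F(1) \<psi> AB]])
    show "(\<lambda>x. indicator A x * (vol_density (Fs (i + n)) x * \<psi> (Fs (i + n) x))) \<in> borel_measurable lborel" for i
      by (rule borel_measurable_integrable[OF integrable_vol_density_mult[OF F(2)[OF n(1)] \<psi> AB]]) simp
    have "emeasure lborel A \<le> emeasure lborel B"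
      using AB by (intro emeasure_mono) (auto intro: borel_compact)
    also have "\<dots> < \<infinity>" using AB(1) by (rule emeasure_compact_finite)
    finally show "integrable lborel (\<lambda>x. indicator A x * c)"
      using AB(3) by auto
    show "AE x in lborel. norm (indicator A x * (vol_density (Fs (i + n)) x * \<psi> (Fs (i + n) x))) \<le> indicator A x * c" for i
      using n(2)[of "i + n"] c[of "J (Fs (i + n)) _"] AB(2) by (intro AE_I2) (auto simp: \<Phi>J split: split_indicator)
    show "AE x in lborel. (\<lambda>i. indicator A x * (vol_density (Fs (i + n)) x * \<psi> (Fs (i + n) x)))
        \<longlonglongrightarrow> indicator A x * (vol_density F x * \<psi> (F x))"
    proof (rule AE_I2)
      fix x
      show "(\<lambda>i. indicator A x * (vol_density (Fs (i + n)) x * \<psi> (Fs (i + n) x)))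
        \<longlonglongrightarrow> indicator A x * (vol_density F x * \<psi> (F x))"
      proof (cases "x \<in> A")
        case True
        then have "(\<lambda>i. J (Fs (i + n)) x) \<longlonglongrightarrow> J F x"
          using AB(2) by (intro LIMSEQ_ignore_initial_segment ptw) auto
        then show ?thesis
          unfolding \<Phi>J using cont
          by (intro tendsto_mult tendsto_const continuous_on_tendsto_compose[of UNIV \<Phi>]) auto
      qed simp
    qed
  qed
  then show ?thesis by (rule LIMSEQ_offset)
qed

text \<open>The integrand pulled back by \<open>f\<close> vanishes outside finitely many disjoint
  pieces, each inside one chart. The pieces \<open>A j\<close> are only Borel; the compact sets
  \<open>B j\<close> around them provide integrability.\<close>

lemma integral_image_measure_charts:
  fixes f :: "'a \<Rightarrow> real^'n::finite" and N :: "('a, 'm::finite) manifold"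
  assumes N: "smooth_manifold N" "C1_map N f" and \<psi>: "continuous_on UNIV (\<psi> :: real^'n \<Rightarrow> real)"
    and J: "finite J" and c: "\<And>j. j \<in> J \<Longrightarrow> compatible_chart N (c j)"
    and AB: "\<And>j. j \<in> J \<Longrightarrow> compact (B j)" "\<And>j. j \<in> J \<Longrightarrow> A j \<subseteq> B j"
      "\<And>j. j \<in> J \<Longrightarrow> A j \<in> sets borel" "\<And>j. j \<in> J \<Longrightarrow> B j \<subseteq> snd (c j) ` fst (c j)"
    and disj: "disjoint_family_on (\<lambda>j. {q \<in> fst (c j). snd (c j) q \<in> A j}) J"
    and cov: "\<And>q. q \<in> carrier N \<Longrightarrow> \<psi> (f q) \<noteq> 0 \<Longrightarrow> \<exists>j\<in>J. q \<in> fst (c j) \<and> snd (c j) q \<in> A j"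
  shows "(\<integral>y. \<psi> y \<partial>image_measure N f) =
    (\<Sum>j\<in>J. \<integral>x. indicator (A j) x * (vol_density (in_chart f (c j)) x * \<psi> (in_chart f (c j) x)) \<partial>lborel)"
proof -
  let ?\<nu> = "volume_measure N f"
  let ?D = "\<lambda>j. {q \<in> fst (c j). snd (c j) q \<in> A j}"
  \<comment> \<open>Cutting off in coordinates gives a Borel function on the whole coordinate space,
    as the chart integral formula requires.\<close>
  define H where "H j x = indicator (A j) x * \<psi> (in_chart f (c j) x)" for j x
  note s = sets_volume_measure[OF N]
  have sp: "space ?\<nu> = carrier N" using sets_eq_imp_space_eq[OF s] by simp
  have C1: "C1_on (snd (c j) ` fst (c j)) (in_chart f (c j))" if "j \<in> J" for j
    by (rule C1_map_in_compatible_chart[OF N c[OF that]])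
  have H: "H j \<in> borel_measurable borel" if j: "j \<in> J" for j
  proof -
    have "continuous_on (snd (c j) ` fst (c j)) (\<lambda>x. \<psi> (in_chart f (c j) x))"
      by (intro continuous_on_compose2[OF \<psi> C1_on_imp_continuous_on[OF C1[OF j]]]) auto
    then have "continuous_on (A j) (\<lambda>x. \<psi> (in_chart f (c j) x))"
      using AB(2,4)[OF j] by (blast intro: continuous_on_subset)
    then show ?thesis
      using borel_measurable_continuous_on_indicator[OF AB(3)[OF j], of "\<lambda>x. \<psi> (in_chart f (c j) x)"]
      by (simp add: H_def[abs_def])
  qed
  have HD: "indicator (fst (c j)) q * H j (snd (c j) q) = indicator (?D j) q * \<psi> (f q)" if "j \<in> J" for j q
    by (auto simp: H_def in_chart_apply[OF c[OF that]] split: split_indicator)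
  have dens: "indicator (snd (c j) ` fst (c j)) x * vol_density (in_chart f (c j)) x * H j x =
      indicator (A j) x * (vol_density (in_chart f (c j)) x * \<psi> (in_chart f (c j) x))" if "j \<in> J" for j x
    using AB(2,4)[OF that] by (auto simp: H_def split: split_indicator)
  have int: "integrable ?\<nu> (\<lambda>q. indicator (fst (c j)) q * H j (snd (c j) q))" if j: "j \<in> J" for j
    unfolding integrable_volume_measure_chart[OF N c[OF j] H[OF j]] dens[OF j]
    by (rule integrable_vol_density_mult[OF C1_on_subset[OF C1[OF j] AB(4)[OF j]] \<psi> AB(1-3)[OF j]])
  \<comment> \<open>Disjointness allows at most one nonzero summand, and \<open>cov\<close> supplies
    one wherever the left side is nonzero.\<close>
  have split: "\<psi> (f q) = (\<Sum>j\<in>J. indicator (fst (c j)) q * H j (snd (c j) q))" if q: "q \<in> carrier N" for q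
  proof -
    have "(\<Sum>j\<in>J. indicator (fst (c j)) q * H j (snd (c j) q)) = (\<Sum>j\<in>J. indicator (?D j) q) * \<psi> (f q)"
      by (simp add: HD sum_distrib_right)
    also have "(\<Sum>j\<in>J. indicator (?D j) q) = (indicator (\<Union>j\<in>J. ?D j) q :: real)"
      by (rule indicator_UN_disjoint[symmetric, OF J disj])
    finally show ?thesis using cov[OF q] by (auto split: split_indicator)
  qed
  have "f \<in> ?\<nu> \<rightarrow>\<^sub>M borel"
    using C1_map_measurable[OF N] by (simp add: measurable_cong_sets[OF s refl])
  moreover have "\<psi> \<in> borel_measurable borel" using \<psi> by (rule borel_measurable_continuous_onI)
  ultimately have "(\<integral>y. \<psi> y \<partial>image_measure N f) = (\<integral>q. \<psi> (f q) \<partial>?\<nu>)"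
    unfolding image_measure_def by (rule integral_distr)
  also have "\<dots> = (\<integral>q. (\<Sum>j\<in>J. indicator (fst (c j)) q * H j (snd (c j) q)) \<partial>?\<nu>)"
    by (rule Bochner_Integration.integral_cong) (use split sp in auto)
  also have "\<dots> = (\<Sum>j\<in>J. \<integral>q. indicator (fst (c j)) q * H j (snd (c j) q) \<partial>?\<nu>)"
    by (rule Bochner_Integration.integral_sum[OF int])
  also have "\<dots> = (\<Sum>j\<in>J. \<integral>x. indicator (A j) x * (vol_density (in_chart f (c j)) x * \<psi> (in_chart f (c j) x)) \<partial>lborel)"
    by (intro sum.cong refl) (simp add: integral_volume_measure_chart[OF N c H] dens)
  finally show ?thesis .
qed

section \<open>Convergence of the image measures\<close>

text \<open>The new chart undoes \<open>\<phi>\<close> and then applies \<open>c\<close>. It is a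
  homeomorphism because \<open>\<phi>\<close> is one, and its transition maps are coordinate
  representations of \<open>\<phi>\<close>. A map \<open>h\<close> read in it is
  \<open>h \<circ> \<phi>\<close> read in \<open>c\<close>.\<close>

lemma transported_chart:
  fixes M :: "('a, 'm::finite) manifold" and N :: "('b, 'm) manifold"
  assumes M: "smooth_manifold M" and N: "smooth_manifold N" and S: "openin (mtop M) S" and T: "openin (mtop N) T"
    and \<phi>: "diffeomorphism M S N T \<phi>" and c: "c \<in> atlas M"
  defines "c' \<equiv> (\<phi> ` (fst c \<inter> S), snd c \<circ> inv_into S \<phi>)"
  shows "compatible_chart N c'"
    and "snd c' ` fst c' = snd c ` (fst c \<inter> S)"
    and "\<And>h x. x \<in> snd c ` (fst c \<inter> S) \<Longrightarrow> in_chart h c' x = in_chart (h \<circ> \<phi>) c x"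
proof -
  have comp: "compatible_chart M c" using M c by (rule atlas_imp_compatible_chart)
  note inj_c = compatible_chart_inj[OF comp]
  have bij: "bij_betw \<phi> S T" and sm: "smooth_between M S N T \<phi>"
    and sm': "smooth_between N T M S (inv_into S \<phi>)"
    using \<phi> by (auto simp: diffeomorphism_def)
  have inj: "inj_on \<phi> S" and im: "\<phi> ` S = T" using bij by (auto simp: bij_betw_def)
  have inv[simp]: "inv_into S \<phi> (\<phi> p) = p" if "p \<in> S" for p using inj that by simp
  have ST: "S \<subseteq> carrier M" "T \<subseteq> carrier N" using S T by (auto simp: openin_subset)
  let ?W = "\<phi> ` (fst c \<inter> S)" and ?z = "snd c \<circ> inv_into S \<phi>"
  have f: "fst c' = ?W" and s: "snd c' = ?z" by (simp_all add: c'_def)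
  have zW: "?z ` \<phi> ` X = snd c ` X" if "X \<subseteq> S" for X
    using that by (force simp: image_image)
  show eq_im: "snd c' ` fst c' = snd c ` (fst c \<inter> S)" unfolding f s by (rule zW) simp
  \<comment> \<open>Continuity of the inverse makes \<open>\<phi>\<close> an open map, since images
    under \<open>\<phi>\<close> are preimages under the inverse.\<close>
  have open_im: "openin (mtop N) (\<phi> ` X)" if X: "openin (mtop M) X" "X \<subseteq> S" for X
  proof -
    have "openin (subtopology (mtop M) S) X" using X S by (simp add: openin_open_subtopology)
    moreover have "continuous_map (subtopology (mtop N) T) (subtopology (mtop M) S) (inv_into S \<phi>)"
      using sm' by (simp add: smooth_between_def)
    ultimately have "openin (subtopology (mtop N) T) {q \<in> topspace (subtopology (mtop N) T). inv_into S \<phi> q \<in> X}"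
      by (simp add: continuous_map_def)
    moreover have "{q \<in> topspace (subtopology (mtop N) T). inv_into S \<phi> q \<in> X} = \<phi> ` X"
      using ST X(2) im by auto
    ultimately show ?thesis using T by (simp add: openin_open_subtopology)
  qed
  have open_vim: "openin (mtop M) {p \<in> S. \<phi> p \<in> Y}" if Y: "openin (mtop N) Y" "Y \<subseteq> T" for Y
  proof -
    have "openin (subtopology (mtop N) T) Y" using Y T by (simp add: openin_open_subtopology)
    moreover have "continuous_map (subtopology (mtop M) S) (subtopology (mtop N) T) \<phi>"
      using sm by (simp add: smooth_between_def)
    ultimately have "openin (subtopology (mtop M) S) {p \<in> topspace (subtopology (mtop M) S). \<phi> p \<in> Y}"
      by (simp add: continuous_map_def)
    moreover have "{p \<in> topspace (subtopology (mtop M) S). \<phi> p \<in> Y} = {p \<in> S. \<phi> p \<in> Y}"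
      using ST by auto
    ultimately show ?thesis using S by (simp add: openin_open_subtopology)
  qed
  have oS: "openin (mtop M) (fst c \<inter> S)" using comp S by (auto simp: compatible_chart_def)
  have oW: "openin (mtop N) ?W" using open_im[OF oS] by simp
  have tsW: "topspace (subtopology (mtop N) ?W) = ?W" using oW by (auto dest: openin_subset)
  have ozW: "open (?z ` ?W)" using zW[of "fst c \<inter> S"] compatible_chart_open_image[OF comp oS] by simp
  have injW: "inj_on ?z ?W" using inj_c by (auto simp: inj_on_def)
  have hom: "homeomorphic_map (subtopology (mtop N) ?W) (top_of_set (?z ` ?W)) ?z"
  proof (rule bijective_open_imp_homeomorphic_map)
    show "continuous_map (subtopology (mtop N) ?W) (top_of_set (?z ` ?W)) ?z"
      unfolding continuous_map_def tsW
    proof (intro conjI allI impI)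
      fix D assume "openin (top_of_set (?z ` ?W)) D"
      then have "open D" using ozW by (simp add: openin_open_eq)
      then have "openin (mtop M) ({p \<in> fst c. snd c p \<in> D} \<inter> S)"
        using compatible_chart_open_vimage[OF comp] S by blast
      then have "openin (mtop N) (\<phi> ` ({p \<in> fst c. snd c p \<in> D} \<inter> S))" by (rule open_im) simp
      moreover have "\<phi> ` ({p \<in> fst c. snd c p \<in> D} \<inter> S) = {q \<in> ?W. ?z q \<in> D}" by auto
      ultimately show "openin (subtopology (mtop N) ?W) {q \<in> ?W. ?z q \<in> D}"
        using oW by (auto simp: openin_open_subtopology)
    qed auto
    show "open_map (subtopology (mtop N) ?W) (top_of_set (?z ` ?W)) ?z"
      unfolding open_map_def
    proof (intro allI impI)
      fix Y assume "openin (subtopology (mtop N) ?W) Y"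
      then have Y: "openin (mtop N) Y" "Y \<subseteq> ?W" using oW by (auto simp: openin_open_subtopology)
      let ?X = "{p \<in> S. \<phi> p \<in> Y}"
      have X: "Y = \<phi> ` ?X" "?X \<subseteq> fst c" using Y(2) inj by (auto dest: inj_onD)
      have "openin (mtop M) ?X" using Y im by (intro open_vim) auto
      then have "open (snd c ` ?X)" using X(2) by (rule compatible_chart_open_image[OF comp])
      also have "snd c ` ?X = ?z ` Y" using zW[of ?X] X(1) by auto
      finally show "openin (top_of_set (?z ` ?W)) (?z ` Y)" using ozW Y(2) by (auto simp: openin_open_eq)
    qed
  qed (use injW tsW in auto)
  show in_c: "in_chart h c' x = in_chart (h \<circ> \<phi>) c x" if x: "x \<in> snd c ` (fst c \<inter> S)" for h x
  proof -
    from x obtain p where p: "p \<in> fst c" "p \<in> S" "x = snd c p" by auto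
    have "in_chart h c' x = h (inv_into ?W ?z (?z (\<phi> p)))" using p by (simp add: in_chart_def f s)
    also have "inv_into ?W ?z (?z (\<phi> p)) = \<phi> p" using p by (intro inv_into_f_f injW) auto
    also have "h (\<phi> p) = in_chart (h \<circ> \<phi>) c x" using p by (simp add: in_chart_apply[OF comp])
    finally show ?thesis .
  qed
  show "compatible_chart N c'"
    unfolding compatible_chart_def f s
  proof (intro conjI oW ozW hom ballI)
    fix d assume d: "d \<in> atlas N"
    let ?X = "{p \<in> fst c \<inter> S. \<phi> p \<in> fst d}"
    have eq: "?z ` (?W \<inter> fst d) = snd c ` ?X"
    proof -
      have "?W \<inter> fst d = \<phi> ` ?X" by auto
      then show ?thesis using zW[of ?X] by auto
    qed
    \<comment> \<open>The transition map from the new chart to \<open>d\<close> is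
      \<open>\<phi>\<close> read in \<open>c\<close> and \<open>d\<close>, which is smooth by the
      definition of \<open>smooth_between\<close>.\<close>
    have C1: "C1_on (snd c ` ?X) (in_chart (snd d \<circ> \<phi>) c)"
    proof (rule smooth_on_imp_C1_on)
      obtain A \<xi> B \<eta> where cd: "c = (A, \<xi>)" "d = (B, \<eta>)" by fastforce
      then show "smooth_on (snd c ` ?X) (in_chart (snd d \<circ> \<phi>) c)"
        using sm c d unfolding smooth_between_def by fastforce
    qed
    have "openin (mtop N) (fst d \<inter> T)"
      using atlas_imp_compatible_chart[OF N d] T by (auto simp: compatible_chart_def)
    then have "openin (mtop M) (fst c \<inter> {p \<in> S. \<phi> p \<in> fst d \<inter> T})"
      using open_vim[of "fst d \<inter> T"] comp unfolding compatible_chart_def by blast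
    also have "fst c \<inter> {p \<in> S. \<phi> p \<in> fst d \<inter> T} = ?X" using im by auto
    finally have "open (snd c ` ?X)" by (rule compatible_chart_open_image[OF comp]) auto
    then show "C1_on (?z ` (?W \<inter> fst d)) (in_chart (snd d) c')"
      unfolding eq by (rule C1_on_cong[OF _ C1]) (auto intro!: in_c[symmetric])
  qed
qed

section \<open>Passage to the limit over a finite cover by chart balls\<close>

theorem corollary1p4:
  fixes M :: "('a, 'm::finite) manifold" and f :: "'a \<Rightarrow> real^'n::finite"
    and Ms :: "nat \<Rightarrow> ('b, 'm) manifold" and fs :: "nat \<Rightarrow> 'b \<Rightarrow> real^'n"
    and C :: "real \<Rightarrow> real" and Ck :: "nat \<Rightarrow> real \<Rightarrow> real"
    and U :: "nat \<Rightarrow> 'a set" and \<phi> :: "nat \<Rightarrow> 'a \<Rightarrow> 'b"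
  assumes "\<And>i. i \<ge> 1 \<Longrightarrow> smooth_manifold (Ms i)"
    and "\<And>i. i \<ge> 1 \<Longrightarrow> proper_immersion (Ms i) (fs i)"
    and "\<And>i. i \<ge> 1 \<Longrightarrow> 0 \<in> fs i ` carrier (Ms i)"
    and "\<And>i R. i \<ge> 1 \<Longrightarrow> R > 0 \<Longrightarrow>
           emeasure (image_measure (Ms i) (fs i)) (ball 0 R) \<le> ennreal (C R)"
    and "\<And>i k R. i \<ge> 1 \<Longrightarrow> R > 0 \<Longrightarrow>
           Linf_norm (volume_measure (Ms i) (fs i)) (preimage (Ms i) (fs i) (ball 0 R))
             (norm_nabla_A k (Ms i) (fs i)) \<le> ereal (Ck k R)"
    and "smooth_manifold M"
    and "proper_immersion M f"
    and "\<And>i. i \<ge> 1 \<Longrightarrow> openin (mtop M) (U i)"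
    and "\<And>i. i \<ge> 1 \<Longrightarrow> compactly_inside M (U i) (U (i + 1))"
    and "carrier M = (\<Union>i\<in>{1..}. U i)"
    and "\<And>i. i \<ge> 1 \<Longrightarrow>
           diffeomorphism M (U i) (Ms i) (preimage (Ms i) (fs i) (ball 0 (real i))) (\<phi> i)"
    and "(\<lambda>i. C0_norm (U i) (\<lambda>p. fs i (\<phi> i p) - f p)) \<longlonglongrightarrow> 0"
    and "locally_smooth_limit M (\<lambda>i. fs i \<circ> \<phi> i) f"
  shows "\<forall>\<psi> :: real^'n \<Rightarrow> real. continuous_on UNIV \<psi> \<and> compact (closure {x. \<psi> x \<noteq> 0}) \<longrightarrow>
    (\<lambda>i. \<integral>x. \<psi> x \<partial>image_measure (Ms i) (fs i)) \<longlonglongrightarrow> (\<integral>x. \<psi> x \<partial>image_measure M f)"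
proof (intro allI impI)
  note smN = assms(1) and propN = assms(2) and smM = assms(6) and propM = assms(7) and Uo = assms(8)
    and Uin = assms(9) and Ucov = assms(10) and diffeo = assms(11) and C0 = assms(12) and lim = assms(13)
  fix \<psi> :: "real^'n \<Rightarrow> real"
  assume "continuous_on UNIV \<psi> \<and> compact (closure {x. \<psi> x \<noteq> 0})"
  then have \<psi>: "continuous_on UNIV \<psi>" and "bounded (closure {x. \<psi> x \<noteq> 0})"
    by (auto intro: compact_imp_bounded)
  then obtain R0 where R0: "\<And>x. x \<in> closure {x. \<psi> x \<noteq> 0} \<Longrightarrow> norm x \<le> R0"
    unfolding bounded_iff by blast
  \<comment> \<open>Adding 1 turns the bound on the support into a strict one.\<close>
  define R where "R = R0 + 1"
  have R: "norm x < R" if "\<psi> x \<noteq> 0" for x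
  proof -
    have "x \<in> closure {x. \<psi> x \<noteq> 0}" using that by (intro subsetD[OF closure_subset]) simp
    from R0[OF this] show ?thesis by (simp add: R_def)
  qed
  have C1M: "C1_map M f" using propM by (simp add: proper_immersion_def smooth_immersion_imp_C1_map)
  have C1N: "C1_map (Ms i) (fs i)" if "i \<ge> 1" for i
    using propN[OF that] by (simp add: proper_immersion_def smooth_immersion_imp_C1_map)
  have U_mono: "U i \<subseteq> U j" if "1 \<le> i" "i \<le> j" for i j
    using that(2,1)
  proof (induction rule: dec_induct)
    case (step n)
    have "U n \<subseteq> mtop M closure_of U n"
      using step openin_subset[OF Uo[of n]] by (intro closure_of_subset) simp
    also have "\<dots> \<subseteq> U (Suc n)" using Uin[of n] step by (auto simp: compactly_inside_def)
    finally show ?case using step by auto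
  qed auto
  \<comment> \<open>The extra unit of radius leaves room for a distance below 1 between
    \<open>fs i \<circ> \<phi> i\<close> and \<open>f\<close>.\<close>
  define K where "K = {p \<in> carrier M. f p \<in> cball 0 (R + 1)}"
  have K: "compactin (mtop M) K"
    unfolding K_def using propM by (intro compactin_proper_map_preimage) (auto simp: proper_immersion_def)
  \<comment> \<open>Closed balls are used to get compact coordinate sets. Each lies over a single
    \<open>U i\<close>, hence by monotonicity over all later ones.\<close>
  have "\<exists>c e i. c \<in> atlas M \<and> p \<in> fst c \<and> e > 0 \<and> i \<ge> 1 \<and> cball (snd c p) e \<subseteq> snd c ` (fst c \<inter> U i)"
    if "p \<in> K" for p
  proof -
    have "p \<in> carrier M" using that by (simp add: K_def)
    then have "p \<in> (\<Union>c\<in>atlas M. fst c)" using smM by (simp add: smooth_manifold_def)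
    then obtain c where c: "c \<in> atlas M" "p \<in> fst c" by blast
    obtain i where i: "i \<ge> 1" "p \<in> U i" using \<open>p \<in> carrier M\<close> unfolding Ucov by auto
    have comp: "compatible_chart M c" using smM c(1) by (rule atlas_imp_compatible_chart)
    have "open (snd c ` (fst c \<inter> U i))"
      using comp Uo[OF i(1)] by (intro compatible_chart_open_image[OF comp]) (auto simp: compatible_chart_def)
    then obtain e where "e > 0" "cball (snd c p) e \<subseteq> snd c ` (fst c \<inter> U i)"
      using c i unfolding open_contains_cball by blast
    with c i show ?thesis by blast
  qed
  then obtain ch e i0 where ch: "\<And>p. p \<in> K \<Longrightarrow> ch p \<in> atlas M" "\<And>p. p \<in> K \<Longrightarrow> p \<in> fst (ch p)"
    "\<And>p. p \<in> K \<Longrightarrow> e p > (0::real)" "\<And>p. p \<in> K \<Longrightarrow> i0 p \<ge> (1::nat)"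
    "\<And>p. p \<in> K \<Longrightarrow> cball (snd (ch p) p) (e p) \<subseteq> snd (ch p) ` (fst (ch p) \<inter> U (i0 p))"
    by metis
  define V where "V p = {q \<in> fst (ch p). snd (ch p) q \<in> ball (snd (ch p) p) (e p)}" for p
  have V_open: "openin (mtop M) (V p)" if "p \<in> K" for p
    unfolding V_def using atlas_imp_compatible_chart[OF smM ch(1)[OF that]]
    by (rule compatible_chart_open_vimage) simp
  have "p \<in> V p" if "p \<in> K" for p using ch(2,3)[OF that] by (simp add: V_def)
  then have "K \<subseteq> \<Union>(V ` K)" by blast
  then obtain \<F> where "finite \<F>" "\<F> \<subseteq> V ` K" "K \<subseteq> \<Union>\<F>"
    using compactinD[OF K, of "V ` K"] V_open by blast
  then obtain P where P: "finite P" "P \<subseteq> K" "K \<subseteq> \<Union>(V ` P)"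
    by (metis finite_subset_image)
  obtain g where g: "bij_betw g {0..<card P} P" using ex_bij_betw_nat_finite[OF P(1)] by blast
  define k where "k = card P"
  define J where "J = {0..<k}"
  have gJ: "g ` J = P" using g by (simp add: bij_betw_def J_def k_def)
  have gK: "g j \<in> K" if "j \<in> J" for j using gJ P(2) that by blast
  define c where "c j = ch (g j)" for j
  define B where "B j = cball (snd (c j) (g j)) (e (g j))" for j
  \<comment> \<open>Removing the earlier balls makes the pieces disjoint without changing their
    union. They are Borel but need not be open, so uniform convergence is used on the closed balls
    \<open>B j\<close> instead.\<close>
  define D where "D = disjointed (\<lambda>j. V (g j))"
  define A where "A j = snd (c j) ` D j" for j
  have cA: "c j \<in> atlas M" and comp: "compatible_chart M (c j)" if "j \<in> J" for j
    using ch(1)[OF gK[OF that]] atlas_imp_compatible_chart[OF smM] by (auto simp: c_def)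
  have DV: "D j \<subseteq> V (g j)" for j unfolding D_def by (rule disjointed_subset)
  have D_fst: "D j \<subseteq> fst (c j)" for j using DV[of j] by (auto simp: V_def c_def)
  have AB: "A j \<subseteq> B j" for j using DV[of j] by (auto simp: A_def B_def V_def c_def)
  have D_borel: "D j \<in> sets (borel_sigma M)" if "j \<in> J" for j
    unfolding D_def disjointed_def using that V_open[OF gK]
    by (intro sets.Diff sets.finite_UN borel_sigma_open) (auto simp: J_def)
  have A_borel: "A j \<in> sets borel" if "j \<in> J" for j
    unfolding A_def by (rule compatible_chart_borel_image[OF comp[OF that] D_borel[OF that] D_fst])
  have B_sub: "B j \<subseteq> snd (c j) ` (fst (c j) \<inter> U (i0 (g j)))" if "j \<in> J" for j
    using ch(5)[OF gK[OF that]] by (simp add: B_def c_def)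
  have B_compact: "compact (B j)" for j by (simp add: B_def)
  have D_disj: "disjoint_family_on D J"
    unfolding D_def using disjoint_family_disjointed[of "\<lambda>j. V (g j)"] by (auto simp: disjoint_family_on_def)
  have "(\<Union>j\<in>J. D j) = (\<Union>j\<in>J. V (g j))"
    unfolding D_def J_def by (rule finite_UN_disjointed_eq)
  also have "\<dots> = \<Union>(V ` P)" by (simp add: gJ[symmetric] image_image)
  finally have K_D: "\<exists>j\<in>J. p \<in> D j" if "p \<in> K" for p using that P(3) by blast
  have D_vimage: "{q \<in> fst (c j). snd (c j) q \<in> A j} = D j" if "j \<in> J" for j
    using D_fst[of j] compatible_chart_inj[OF comp[OF that]] by (auto simp: A_def dest: inj_onD)
  let ?T = "\<lambda>F j. \<integral>x. indicator (A j) x * (vol_density (F j) x * \<psi> (F j x)) \<partial>lborel"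
  have int_M: "(\<integral>y. \<psi> y \<partial>image_measure M f) = (\<Sum>j\<in>J. ?T (\<lambda>j. in_chart f (c j)) j)"
  proof (rule integral_image_measure_charts[OF smM C1M \<psi> _ comp B_compact AB A_borel])
    show "disjoint_family_on (\<lambda>j. {q \<in> fst (c j). snd (c j) q \<in> A j}) J"
      using D_disj by (auto simp: disjoint_family_on_def D_vimage)
    show "B j \<subseteq> snd (c j) ` fst (c j)" if "j \<in> J" for j using B_sub[OF that] by auto
    fix q assume q: "q \<in> carrier M" "\<psi> (f q) \<noteq> 0"
    then have "q \<in> K" using R[of "f q"] by (simp add: K_def)
    then obtain j where "j \<in> J" "q \<in> D j" using K_D by blast
    then show "\<exists>j\<in>J. q \<in> fst (c j) \<and> snd (c j) q \<in> A j" using D_fst by (auto simp: A_def)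
  qed (auto simp: J_def)
  have "\<forall>\<^sub>F i in sequentially. \<forall>j\<in>J. i0 (g j) \<le> i"
    by (intro eventually_ball_finite) (auto simp: J_def)
  moreover have "\<forall>\<^sub>F i in sequentially. C0_norm (U i) (\<lambda>p. fs i (\<phi> i p) - f p) < 1"
    using order_tendstoD(2)[OF C0] by simp
  moreover have "\<forall>\<^sub>F i in sequentially. R < real i"
    using eventually_gt_at_top[of "nat \<lceil>R\<rceil>"] by eventually_elim linarith
  \<comment> \<open>For such \<open>i\<close> all the balls \<open>B j\<close> lie over
    \<open>U i\<close>, the image of \<open>\<phi> i\<close> contains every point that
    \<open>fs i\<close> sends into the support of \<open>\<psi>\<close>, and the maps are within
    distance 1.\<close>
  ultimately have "\<forall>\<^sub>F i in sequentially. i \<ge> 1 \<and> R < real i \<and> (\<forall>j\<in>J. i0 (g j) \<le> i) \<and>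
      (\<forall>p\<in>U i. norm (fs i (\<phi> i p) - f p) < 1)"
    using eventually_ge_at_top[of 1]
  proof eventually_elim
    case (elim i)
    have "norm (fs i (\<phi> i p) - f p) < 1" if "p \<in> U i" for p
    proof -
      have "ennreal (norm (fs i (\<phi> i p) - f p)) \<le> C0_norm (U i) (\<lambda>p. fs i (\<phi> i p) - f p)"
        unfolding C0_norm_def using that by (rule SUP_upper)
      also have "\<dots> < ennreal 1" using elim by simp
      finally show ?thesis by (subst (asm) ennreal_less_iff) auto
    qed
    with elim show ?case by blast
  qed
  then obtain I where I: "\<And>i. i \<ge> I \<Longrightarrow> i \<ge> 1" "\<And>i. i \<ge> I \<Longrightarrow> R < real i"
    "\<And>i j. i \<ge> I \<Longrightarrow> j \<in> J \<Longrightarrow> i0 (g j) \<le> i"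
    "\<And>i p. i \<ge> I \<Longrightarrow> p \<in> U i \<Longrightarrow> norm (fs i (\<phi> i p) - f p) < 1"
    by (auto simp: eventually_sequentially)
  define F where "F i j = in_chart (fs i \<circ> \<phi> i) (c j)" for i j
  have BU: "B j \<subseteq> snd (c j) ` (fst (c j) \<inter> U i)" if "i \<ge> I" "j \<in> J" for i j
    using B_sub[OF that(2)] U_mono[OF ch(4)[OF gK[OF that(2)]] I(3)[OF that]] by blast
  have chart: "\<And>j. j \<in> J \<Longrightarrow> C1_on (B j) (F i j)"
    and int_N: "(\<integral>y. \<psi> y \<partial>image_measure (Ms i) (fs i)) = (\<Sum>j\<in>J. ?T (F i) j)"
    if i: "i \<ge> I" for i
  proof -
    let ?N = "Ms i" and ?T' = "preimage (Ms i) (fs i) (ball 0 (real i))"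
    note i1 = I(1)[OF i]
    note smi = smN[OF i1] and C1i = C1N[OF i1] and df = diffeo[OF i1] and Ui = Uo[OF i1]
    have bij: "bij_betw (\<phi> i) (U i) ?T'" using df by (simp add: diffeomorphism_def)
    then have inj: "inj_on (\<phi> i) (U i)" and im: "\<phi> i ` U i = ?T'" by (auto simp: bij_betw_def)
    have T': "openin (mtop ?N) ?T'"
      unfolding preimage_def by (rule C1_map_open_vimage[OF smi C1i open_ball])
    \<comment> \<open>The charts of the limit are pushed forward by \<open>\<phi> i\<close>, so that
      the integrals for every \<open>i\<close> run over the same coordinate sets
      \<open>A j\<close>.\<close>
    define c' where "c' j = (\<phi> i ` (fst (c j) \<inter> U i), snd (c j) \<circ> inv_into (U i) (\<phi> i))" for j
    let ?O = "\<lambda>j. snd (c j) ` (fst (c j) \<inter> U i)"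
    have c': "compatible_chart ?N (c' j)" "snd (c' j) ` fst (c' j) = ?O j"
      "\<And>x. x \<in> ?O j \<Longrightarrow> in_chart (fs i) (c' j) x = F i j x" if "j \<in> J" for j
      using transported_chart[OF smM smi Ui T' df cA[OF that]] unfolding c'_def F_def by blast+
    have O: "open (?O j)" if "j \<in> J" for j
      using c'(1)[OF that] unfolding c'(2)[OF that, symmetric] compatible_chart_def by blast
    have C1': "C1_on (?O j) (in_chart (fs i) (c' j))" if "j \<in> J" for j
      using C1_map_in_compatible_chart[OF smi C1i c'(1)[OF that]] c'(2)[OF that] by simp
    show "C1_on (B j) (F i j)" if "j \<in> J" for j
      using C1_on_subset[OF C1_on_cong[OF O C1' c'(3)] BU[OF i]] that by blast
    have DU: "D j \<subseteq> U i" if j: "j \<in> J" for j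
    proof
      fix p assume p: "p \<in> D j"
      then have "snd (c j) p \<in> ?O j" using AB[of j] BU[OF i j] by (auto simp: A_def)
      then show "p \<in> U i"
        using p D_fst[of j] compatible_chart_inj[OF comp[OF j]] by (auto dest: inj_onD)
    qed
    have D_vimage': "{q \<in> fst (c' j). snd (c' j) q \<in> A j} = \<phi> i ` D j" if j: "j \<in> J" for j
    proof -
      have "{q \<in> fst (c' j). snd (c' j) q \<in> A j} = \<phi> i ` ({p \<in> fst (c j). snd (c j) p \<in> A j} \<inter> U i)"
        using inj by (auto simp: c'_def)
      also have "\<dots> = \<phi> i ` D j" unfolding D_vimage[OF j] using DU[OF j] by (simp add: Int_absorb2)
      finally show ?thesis .
    qed
    have "(\<integral>y. \<psi> y \<partial>image_measure ?N (fs i)) = (\<Sum>j\<in>J. ?T (\<lambda>j. in_chart (fs i) (c' j)) j)"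
    proof (rule integral_image_measure_charts[OF smi C1i \<psi> _ c'(1) B_compact AB A_borel])
      show "B j \<subseteq> snd (c' j) ` fst (c' j)" if "j \<in> J" for j using BU[OF i that] c'(2)[OF that] by simp
      show "disjoint_family_on (\<lambda>j. {q \<in> fst (c' j). snd (c' j) q \<in> A j}) J"
        unfolding disjoint_family_on_def
      proof (intro ballI impI)
        fix j l assume jl: "j \<in> J" "l \<in> J" "j \<noteq> l"
        then have "\<phi> i ` D j \<inter> \<phi> i ` D l = {}"
          using D_disj DU inj_on_image_Int[OF inj, of "D j" "D l"] by (auto simp: disjoint_family_on_def)
        then show "{q \<in> fst (c' j). snd (c' j) q \<in> A j} \<inter> {q \<in> fst (c' l). snd (c' l) q \<in> A l} = {}"
          using jl by (simp add: D_vimage')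
      qed
      fix q assume q: "q \<in> carrier ?N" "\<psi> (fs i q) \<noteq> 0"
      have "norm (fs i q) < R" using q R by blast
      then have "q \<in> ?T'" using I(2)[OF i] q by (simp add: preimage_def)
      then obtain p where p: "p \<in> U i" "q = \<phi> i p" using im by blast
      \<comment> \<open>Here the unit margin in \<open>K\<close> is spent: a point that
        \<open>fs i\<close> sends into the support comes from a point of \<open>K\<close>, hence
        from some piece \<open>D j\<close>.\<close>
      have "norm (f p) \<le> norm (fs i q) + norm (fs i q - f p)"
        using norm_triangle_ineq4[of "fs i q" "fs i q - f p"] by simp
      then have "norm (f p) \<le> R + 1"
        using \<open>norm (fs i q) < R\<close> I(4)[OF i p(1)] p(2) by simp
      then have "p \<in> K" using p(1) openin_subset[OF Ui] by (auto simp: K_def)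
      then obtain j where j: "j \<in> J" "p \<in> D j" using K_D by blast
      then show "\<exists>j\<in>J. q \<in> fst (c' j) \<and> snd (c' j) q \<in> A j"
        using D_vimage'[OF j(1)] p(2) by blast
    qed (auto simp: J_def)
    \<comment> \<open>The two representations are known to agree only on the open set
      \<open>?O j\<close>. It contains \<open>A j\<close>, and openness carries the agreement over
      to the densities.\<close>
    also have "\<dots> = (\<Sum>j\<in>J. ?T (F i) j)"
    proof (intro sum.cong refl Bochner_Integration.integral_cong)
      fix j x assume j: "j \<in> J"
      have "vol_density (in_chart (fs i) (c' j)) x = vol_density (F i j) x" if "x \<in> ?O j"
        using C1'[OF j] that unfolding C1_on_def
        by (intro vol_density_cong_open[OF O[OF j] that _ c'(3)[OF j]]) auto
      then show "indicator (A j) x * (vol_density (in_chart (fs i) (c' j)) x * \<psi> (in_chart (fs i) (c' j) x)) =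
          indicator (A j) x * (vol_density (F i j) x * \<psi> (F i j x))"
        using AB[of j] BU[OF i j] c'(3)[OF j, of x] by (auto split: split_indicator)
    qed
    finally show "(\<integral>y. \<psi> y \<partial>image_measure ?N (fs i)) = (\<Sum>j\<in>J. ?T (F i) j)" .
  qed
  have "(\<lambda>i. \<Sum>j\<in>J. ?T (F i) j) \<longlonglongrightarrow> (\<Sum>j\<in>J. ?T (\<lambda>j. in_chart f (c j)) j)"
  proof (intro tendsto_sum)
    fix j assume j: "j \<in> J"
    have Bc: "B j \<subseteq> snd (c j) ` fst (c j)" using B_sub[OF j] by auto
    \<comment> \<open>Of the convergence of all derivatives, the lists of length 0 and 1 are used
      below: values and first partials.\<close>
    have ul: "uniform_limit (B j) (\<lambda>i. partials as (F i j)) (partials as (in_chart f (c j))) sequentially" for as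
      unfolding F_def using lim cA[OF j] B_compact Bc unfolding locally_smooth_limit_def by blast
    show "(\<lambda>i. ?T (F i) j) \<longlonglongrightarrow> ?T (\<lambda>j. in_chart f (c j)) j"
    proof (rule tendsto_integral_vol_density[OF _ chart _ _ \<psi> B_compact AB A_borel[OF j]])
      show "C1_on (B j) (in_chart f (c j))"
        using C1_on_subset[OF C1_map_in_compatible_chart[OF smM C1M comp[OF j]] Bc] .
      show "uniform_limit (B j) (\<lambda>i. F i j) (in_chart f (c j)) sequentially"
        using ul[of "[]"] by (simp add: partials_def)
      show "uniform_limit (B j) (\<lambda>i. partial a (F i j)) (partial a (in_chart f (c j))) sequentially" for a
        using ul[of "[a]"] by (simp add: partials_def)
    qed (use j in auto)
  qed
  \<comment> \<open>The chart formula for the integrals of \<open>fs i\<close> holds from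
    \<open>I\<close> on, so the limits are compared eventually.\<close>
  then show "(\<lambda>i. \<integral>y. \<psi> y \<partial>image_measure (Ms i) (fs i)) \<longlonglongrightarrow> (\<integral>y. \<psi> y \<partial>image_measure M f)"
    unfolding int_M by (rule Lim_transform_eventually)
      (auto simp: eventually_sequentially int_N intro!: exI[of _ I])
qed

end
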